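(* Let $p$ be a prime, let $G$ be a finite $p$-group, let $G_1,\ldots,G_n$ be subgroups of $G$ such that $|G_{i+1}|\ge |G_i|$ for $1\le i<n$, and let $M$ be a finitely generated $\mathbf{F}_p[G]$-module. Define submodules $M_0,M_1,\ldots,M_n$ of $M$ by $M_0=0$ and, for $1\le i\le n$, $$M_i = M_{i-1} + \mathrm{Im}\Bigl(\bigl(\textstyle\sum_{g\in G/G_i}g\bigr) : M^{G_i} \rightarrow M\Bigr),$$ where the sum ranges over a (left) transversal to $G_i$ in $G$, $M^{G_i}$ denotes the $G_i$-fixed points of $M$, and the sum is an element of $\mathbf{F}_p[G]$ acting on $M$. Let $m_i=\dim_{\mathbf{F}_p} M_i-\dim_{\mathbf{F}_p} M_{i-1}$. Then $M$ contains a submodule $M'$ with $$M'\cong m_1\,\mathbf{F}_p[G/G_1]\oplus\cdots\oplus m_n\,\mathbf{F}_p[G/G_n],$$ and $M'$ has maximal dimension among all submodules of $M$ isomorphic to a direct sum of copies of the modules $\mathbf{F}_p[G/G_i]$, $1\le i\le n$. The dimension of $M'$ is $\sum_i m_i|G:G_i|$. If $G_1,\ldots,G_n$ contains a representative of each conjugacy class of subgroups of $G$, then $\dim M'=\dim M$ if and only if $M$ is a permutation module.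
   Context: For a $G$-set $S$, $\mathbf{F}_p[S]$ is the $\mathbf{F}_p[G]$-module with basis $S$ permuted by $G$; an $\mathbf{F}_p[G]$-module is a permutation module if it has an $\mathbf{F}_p$-basis permuted by $G$. The notation $m N$ means the direct sum of $m$ copies of $N$. *)

theory Defs
  imports
    "HOL-Algebra.Left_Coset"
    "HOL-Library.Poly_Mapping"
    "Berlekamp_Zassenhaus.Finite_Field"
begin

text \<open>
  A module over the group algebra \<open>k[G]\<close> is encoded as a \<open>k\<close>-vector space with a \<open>k\<close>-linear
  action of \<open>G\<close>; addition is that of the type class. As usual for HOL-Algebra records, a submodule
  with underlying set \<open>N\<close> is the record \<open>M\<lparr>carrier := N\<rparr>\<close>. The field \<open>F\<^sub>p\<close> is
  \<open>'p mod_ring\<close> with \<open>'p :: prime_card\<close> and \<open>p = CARD('p)\<close>.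
\<close>

record ('k, 'g, 'm) kG_mod = "'m partial_object" +
  smul :: "'k \<Rightarrow> 'm \<Rightarrow> 'm"
  act :: "'g \<Rightarrow> 'm \<Rightarrow> 'm"

locale kG_module = group G + vector_space "smul M"
  for G :: "('g, 'b) monoid_scheme" (structure)
    and M :: "('k::field, 'g, 'm::ab_group_add) kG_mod" +
  assumes subspace_carrier: "module.subspace (smul M) (carrier M)"
    and act_closed: "\<lbrakk>g \<in> carrier G; x \<in> carrier M\<rbrakk> \<Longrightarrow> act M g x \<in> carrier M"
    and act_add: "\<lbrakk>g \<in> carrier G; x \<in> carrier M; y \<in> carrier M\<rbrakk>
                    \<Longrightarrow> act M g (x + y) = act M g x + act M g y"
    and act_smul: "\<lbrakk>g \<in> carrier G; x \<in> carrier M\<rbrakk>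
                    \<Longrightarrow> act M g (smul M c x) = smul M c (act M g x)"
    and act_one: "x \<in> carrier M \<Longrightarrow> act M \<one> x = x"
    and act_mult: "\<lbrakk>g \<in> carrier G; h \<in> carrier G; x \<in> carrier M\<rbrakk>
                    \<Longrightarrow> act M (g \<otimes> h) x = act M g (act M h x)"

definition kG_submodule ::
  "('g, 'b) monoid_scheme \<Rightarrow> 'm set \<Rightarrow> ('k::field, 'g, 'm::ab_group_add) kG_mod \<Rightarrow> bool" where
  "kG_submodule G N M \<longleftrightarrow>
     N \<subseteq> carrier M \<and> module.subspace (smul M) N \<and> (\<forall>g\<in>carrier G. \<forall>x\<in>N. act M g x \<in> N)"

definition kG_fin_gen ::
  "('g, 'b) monoid_scheme \<Rightarrow> ('k::field, 'g, 'm::ab_group_add) kG_mod \<Rightarrow> bool" where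
  "kG_fin_gen G M \<longleftrightarrow>
     (\<exists>B. finite B \<and> B \<subseteq> carrier M \<and> (\<lambda>N. kG_submodule G N M) hull B = carrier M)"

abbreviation kdim :: "('k::field, 'g, 'm::ab_group_add) kG_mod \<Rightarrow> 'm set \<Rightarrow> nat" where
  "kdim M N \<equiv> vector_space.dim (smul M) N"

definition kG_iso ::
  "('g, 'b) monoid_scheme \<Rightarrow> ('k::field, 'g, 'm::ab_group_add) kG_mod
     \<Rightarrow> ('k, 'g, 'n::ab_group_add) kG_mod \<Rightarrow> bool" where
  "kG_iso G M N \<longleftrightarrow>
     (\<exists>f. bij_betw f (carrier M) (carrier N) \<and>
          (\<forall>x\<in>carrier M. \<forall>y\<in>carrier M. f (x + y) = f x + f y) \<and>
          (\<forall>c. \<forall>x\<in>carrier M. f (smul M c x) = smul N c (f x)) \<and>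
          (\<forall>g\<in>carrier G. \<forall>x\<in>carrier M. f (act M g x) = act N g (f x)))"

text \<open>
  \<open>k[S]\<close> for a \<open>G\<close>-set \<open>S\<close> with action \<open>\<phi>\<close>: finitely supported functions \<open>S \<Rightarrow> k\<close>, where
  \<open>Poly_Mapping.single s 1\<close> is the basis vector \<open>s\<close> and \<open>g\<close> sends it to \<open>\<phi> g s\<close>.
\<close>

definition perm_module :: "'s set \<Rightarrow> ('g \<Rightarrow> 's \<Rightarrow> 's) \<Rightarrow> ('k::field, 'g, 's \<Rightarrow>\<^sub>0 'k) kG_mod" where
  "perm_module S \<phi> =
     \<lparr>carrier = {f. Poly_Mapping.keys f \<subseteq> S},
      smul = (\<lambda>c. Poly_Mapping.map ((*) c)),
      act = (\<lambda>g f. \<Sum>s\<in>Poly_Mapping.keys f.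
                Poly_Mapping.single (\<phi> g s) (Poly_Mapping.lookup f s))\<rparr>"

definition coset_module ::
  "('g, 'b) monoid_scheme \<Rightarrow> 'g set \<Rightarrow> ('k::field, 'g, 'g set \<Rightarrow>\<^sub>0 'k) kG_mod" where
  "coset_module G H = perm_module (lcosets\<^bsub>G\<^esub> H) (\<lambda>g C. g <#\<^bsub>G\<^esub> C)"

definition is_permutation_module ::
  "('g, 'b) monoid_scheme \<Rightarrow> ('k::field, 'g, 'm::ab_group_add) kG_mod \<Rightarrow> bool" where
  "is_permutation_module G M \<longleftrightarrow>
     (\<exists>B. B \<subseteq> carrier M \<and> \<not> module.dependent (smul M) B \<and> module.span (smul M) B = carrier M \<and>
          (\<forall>g\<in>carrier G. bij_betw (act M g) B B))"

definition direct_sum ::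
  "'i set \<Rightarrow> ('i \<Rightarrow> ('k::field, 'g, 'm::ab_group_add) kG_mod) \<Rightarrow> ('k, 'g, 'i \<Rightarrow>\<^sub>0 'm) kG_mod" where
  "direct_sum I V =
     \<lparr>carrier = {f. Poly_Mapping.keys f \<subseteq> I \<and> (\<forall>i\<in>I. Poly_Mapping.lookup f i \<in> carrier (V i))},
      smul = (\<lambda>c. Poly_Mapping.mapp (\<lambda>i. smul (V i) c)),
      act = (\<lambda>g. Poly_Mapping.mapp (\<lambda>i. act (V i) g))\<rparr>"

definition copies ::
  "nat \<Rightarrow> ('k::field, 'g, 'm::ab_group_add) kG_mod \<Rightarrow> ('k, 'g, nat \<Rightarrow>\<^sub>0 'm) kG_mod" where
  "copies m N = direct_sum {..<m} (\<lambda>_. N)"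

definition fixed_points :: "('k, 'g, 'm) kG_mod \<Rightarrow> 'g set \<Rightarrow> 'm set" where
  "fixed_points M H = {x \<in> carrier M. \<forall>h\<in>H. act M h x = x}"

definition left_transversal :: "('g, 'b) monoid_scheme \<Rightarrow> 'g set \<Rightarrow> 'g set \<Rightarrow> bool" where
  "left_transversal G H T \<longleftrightarrow> T \<subseteq> carrier G \<and> (\<forall>C\<in>lcosets\<^bsub>G\<^esub> H. \<exists>!t. t \<in> T \<inter> C)"

primrec trace_filtration ::
  "('k, 'g, 'm::ab_group_add) kG_mod \<Rightarrow> (nat \<Rightarrow> 'g set) \<Rightarrow> (nat \<Rightarrow> 'g set) \<Rightarrow> nat \<Rightarrow> 'm set" where
  "trace_filtration M H T 0 = {0}"
| "trace_filtration M H T (Suc i) =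
     {x + y | x y. x \<in> trace_filtration M H T i \<and>
        y \<in> (\<lambda>v. \<Sum>t\<in>T (Suc i). act M t v) ` fixed_points M (H (Suc i))}"

text \<open>The constructions above yield modules, and the trace filtration is increasing.\<close>

lemma kG_module_perm_module:
  assumes "group G"
    and cl: "\<And>g s. \<lbrakk>g \<in> carrier G; s \<in> S\<rbrakk> \<Longrightarrow> \<phi> g s \<in> S"
    and one: "\<And>s. s \<in> S \<Longrightarrow> \<phi> \<one>\<^bsub>G\<^esub> s = s"
    and mult: "\<And>g h s. \<lbrakk>g \<in> carrier G; h \<in> carrier G; s \<in> S\<rbrakk>
                 \<Longrightarrow> \<phi> (g \<otimes>\<^bsub>G\<^esub> h) s = \<phi> g (\<phi> h s)"
  shows "kG_module G (perm_module S \<phi> :: ('k::field, 'g, 's \<Rightarrow>\<^sub>0 'k) kG_mod)"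
proof -
  interpret group G by fact
  let ?P = "perm_module S \<phi> :: ('k::field, 'g, 's \<Rightarrow>\<^sub>0 'k) kG_mod"
  have smul: "Poly_Mapping.lookup (smul ?P c f) s = c * Poly_Mapping.lookup f s" for c f s
    by (simp add: perm_module_def Poly_Mapping.map.rep_eq when_def)
  have vs: "vector_space (smul ?P)"
    by unfold_locales
      (auto intro!: poly_mapping_eqI simp: smul lookup_add algebra_simps)
  interpret vector_space "smul ?P" by (fact vs)
  have act_lookup: "Poly_Mapping.lookup (act ?P g f) s =
      (\<Sum>t\<in>A. if \<phi> g t = s then Poly_Mapping.lookup f t else 0)"
    if "finite A" "Poly_Mapping.keys f \<subseteq> A" for g f s A
  proof -
    have "Poly_Mapping.lookup (act ?P g f) s =
       (\<Sum>t\<in>Poly_Mapping.keys f. if \<phi> g t = s then Poly_Mapping.lookup f t else 0)"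
      by (simp add: perm_module_def lookup_sum lookup_single when_def)
    also have "\<dots> = (\<Sum>t\<in>A. if \<phi> g t = s then Poly_Mapping.lookup f t else 0)"
      by (rule sum.mono_neutral_left) (use that in \<open>auto simp: in_keys_iff\<close>)
    finally show ?thesis .
  qed
  have act_at: "Poly_Mapping.lookup (act ?P g f) s =
      (if s \<in> S then Poly_Mapping.lookup f (\<phi> (inv\<^bsub>G\<^esub> g) s) else 0)"
    if "g \<in> carrier G" "f \<in> carrier ?P" for g f s
  proof -
    have f: "Poly_Mapping.keys f \<subseteq> S" using that by (simp add: perm_module_def)
    have *: "\<phi> g t = s \<longleftrightarrow> s \<in> S \<and> t = \<phi> (inv\<^bsub>G\<^esub> g) s" if t: "t \<in> S" for t
      using t \<open>g \<in> carrier G\<close> cl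
      by (metis inv_closed l_inv mult one r_inv)
    have "Poly_Mapping.lookup (act ?P g f) s =
       (\<Sum>t\<in>Poly_Mapping.keys f. if \<phi> g t = s then Poly_Mapping.lookup f t else 0)"
      by (rule act_lookup) auto
    also have "\<dots> = (\<Sum>t\<in>Poly_Mapping.keys f.
        if t = \<phi> (inv\<^bsub>G\<^esub> g) s then (if s \<in> S then Poly_Mapping.lookup f t else 0) else 0)"
      using * f by (intro sum.cong) auto
    also have "\<dots> = (if s \<in> S then Poly_Mapping.lookup f (\<phi> (inv\<^bsub>G\<^esub> g) s) else 0)"
      by (simp add: sum.delta in_keys_iff)
    finally show ?thesis .
  qed
  have zeroS: "Poly_Mapping.lookup f s = 0" if "f \<in> carrier ?P" "s \<notin> S" for f s
    using that by (auto simp: perm_module_def in_keys_iff)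
  have carrierI: "f \<in> carrier ?P" if "\<And>s. s \<notin> S \<Longrightarrow> Poly_Mapping.lookup f s = 0" for f
    using that by (auto simp: perm_module_def in_keys_iff)
  have sub: "subspace (carrier ?P)"
    by (rule subspaceI) (auto intro!: carrierI simp: lookup_add smul zeroS)
  have acl: "act ?P g f \<in> carrier ?P" if "g \<in> carrier G" "f \<in> carrier ?P" for g f
    using that by (auto intro!: carrierI simp: act_at)
  show ?thesis
  proof unfold_locales
    fix g h f assume *: "g \<in> carrier G" "h \<in> carrier G" "f \<in> carrier ?P"
    show "act ?P (g \<otimes>\<^bsub>G\<^esub> h) f = act ?P g (act ?P h f)"
      using * by (intro poly_mapping_eqI)
        (simp add: act_at acl cl inv_mult_group mult)
  next
    fix f assume "f \<in> carrier ?P"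
    then show "act ?P \<one>\<^bsub>G\<^esub> f = f"
      by (intro poly_mapping_eqI) (simp add: act_at zeroS one)
  next
    fix g f f' assume *: "g \<in> carrier G" "f \<in> carrier ?P" "f' \<in> carrier ?P"
    then show "act ?P g (f + f') = act ?P g f + act ?P g f'"
      using subspace_add[OF sub, of f f']
      by (intro poly_mapping_eqI) (simp add: act_at lookup_add)
  next
    fix g f c assume *: "g \<in> carrier G" "f \<in> carrier ?P"
    then show "act ?P g (smul ?P c f) = smul ?P c (act ?P g f)"
      using subspace_scale[OF sub, of f c]
      by (intro poly_mapping_eqI) (simp add: act_at smul)
  qed (use sub acl in auto)
qed

lemma kG_module_coset_module:
  assumes "group G" "subgroup H G"
  shows "kG_module G (coset_module G H :: ('k::field, 'g, 'g set \<Rightarrow>\<^sub>0 'k) kG_mod)"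
proof -
  interpret group G by fact
  have H: "H \<subseteq> carrier G" using assms(2) by (rule subgroup.subset)
  show ?thesis
    unfolding coset_module_def
    by (rule kG_module_perm_module[OF assms(1)])
      (use H in \<open>auto simp: LCOSETS_def m_assoc lcos_m_assoc l_coset_subset_G lcos_mult_one\<close>)
qed

lemma kG_module_direct_sum:
  assumes "group G" "\<And>i. vector_space (smul (V i))" "\<And>i. i \<in> I \<Longrightarrow> kG_module G (V i)"
  shows "kG_module G (direct_sum I V)"
proof -
  interpret group G by fact
  interpret V: vector_space "smul (V i)" for i by (rule assms)
  let ?D = "direct_sum I V"
  have smul: "Poly_Mapping.lookup (smul ?D c f) i = smul (V i) c (Poly_Mapping.lookup f i)" for c f i
    by (simp add: direct_sum_def lookup_mapp when_def in_keys_iff)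
  interpret vector_space "smul ?D"
    by unfold_locales
      (auto intro!: poly_mapping_eqI simp: smul lookup_add V.scale_right_distrib V.scale_left_distrib)
  have lk0: "Poly_Mapping.lookup f i = 0" if "f \<in> carrier ?D" "i \<notin> I" for f i
    using that by (auto simp: direct_sum_def in_keys_iff)
  have lkV: "Poly_Mapping.lookup f i \<in> carrier (V i)" if "f \<in> carrier ?D" "i \<in> I" for f i
    using that by (auto simp: direct_sum_def)
  have carrierI: "f \<in> carrier ?D"
    if "\<And>i. i \<notin> I \<Longrightarrow> Poly_Mapping.lookup f i = 0"
       "\<And>i. i \<in> I \<Longrightarrow> Poly_Mapping.lookup f i \<in> carrier (V i)" for f
    using that by (auto simp: direct_sum_def in_keys_iff)
  have sV: "V.subspace i (carrier (V i))" if "i \<in> I" for i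
    using assms(3)[OF that] by (rule kG_module.subspace_carrier)
  have act0: "act (V i) g 0 = 0" if "i \<in> I" "g \<in> carrier G" for i g
    using kG_module.act_smul[OF assms(3)[OF that(1)] that(2), of 0 0] V.subspace_0[OF sV[OF that(1)]]
    by simp
  have act_at: "Poly_Mapping.lookup (act ?D g f) i =
      (if i \<in> I then act (V i) g (Poly_Mapping.lookup f i) else 0)"
    if "g \<in> carrier G" "f \<in> carrier ?D" for g f i
    using that lk0[OF that(2), of i] act0[of i g]
    by (auto simp: direct_sum_def lookup_mapp when_def in_keys_iff)
  have sub: "subspace (carrier ?D)"
    by (rule subspaceI)
      (auto intro!: carrierI simp: lookup_add smul lk0 lkV V.subspace_0[OF sV]
        V.subspace_add[OF sV] V.subspace_scale[OF sV])
  have acl: "act ?D g f \<in> carrier ?D" if "g \<in> carrier G" "f \<in> carrier ?D" for g f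
    using that by (intro carrierI) (auto simp: act_at lkV intro: kG_module.act_closed[OF assms(3)])
  show ?thesis
  proof unfold_locales
    fix g h f assume *: "g \<in> carrier G" "h \<in> carrier G" "f \<in> carrier ?D"
    then show "act ?D (g \<otimes>\<^bsub>G\<^esub> h) f = act ?D g (act ?D h f)"
      by (intro poly_mapping_eqI) (simp add: act_at acl lkV kG_module.act_mult[OF assms(3)])
  next
    fix f assume "f \<in> carrier ?D"
    then show "act ?D \<one>\<^bsub>G\<^esub> f = f"
      by (intro poly_mapping_eqI) (simp add: act_at lk0 lkV kG_module.act_one[OF assms(3)])
  next
    fix g f f' assume *: "g \<in> carrier G" "f \<in> carrier ?D" "f' \<in> carrier ?D"
    then show "act ?D g (f + f') = act ?D g f + act ?D g f'"
      using subspace_add[OF sub, of f f']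
      by (intro poly_mapping_eqI) (simp add: act_at lookup_add lkV kG_module.act_add[OF assms(3)])
  next
    fix g f c assume *: "g \<in> carrier G" "f \<in> carrier ?D"
    then show "act ?D g (smul ?D c f) = smul ?D c (act ?D g f)"
      using subspace_scale[OF sub, of f c]
      by (intro poly_mapping_eqI) (simp add: act_at smul lkV kG_module.act_smul[OF assms(3)])
  qed (use sub acl in auto)
qed

lemma trace_filtration_mono:
  assumes "kG_module G M" "T (Suc i) \<subseteq> carrier G" "H (Suc i) \<subseteq> carrier G"
  shows "trace_filtration M H T i \<subseteq> trace_filtration M H T (Suc i)"
proof -
  interpret kG_module G M by fact
  have 0: "0 \<in> carrier M" using subspace_carrier by (rule subspace_0)
  have a0: "act M g 0 = 0" if "g \<in> carrier G" for g
    using act_smul[OF that 0, of 0] by simp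
  have "0 \<in> (\<lambda>v. \<Sum>t\<in>T (Suc i). act M t v) ` fixed_points M (H (Suc i))"
    using 0 a0 assms(2,3)
    by (intro image_eqI[of _ _ 0]) (auto simp: fixed_points_def subset_iff intro!: sum.neutral)
  then show ?thesis by force
qed

text \<open>The truncated subtraction is harmless by the monotonicity above.\<close>

definition layer_dim ::
  "('k::field, 'g, 'm::ab_group_add) kG_mod \<Rightarrow> (nat \<Rightarrow> 'g set) \<Rightarrow> (nat \<Rightarrow> 'g set) \<Rightarrow> nat \<Rightarrow> nat" where
  "layer_dim M H T i =
     kdim M (trace_filtration M H T i) - kdim M (trace_filtration M H T (i - 1))"

end

theory Submission
  imports Defs "HOL-Algebra.Group_Action"
begin

text \<open>
  A nonzero module of a \<open>p\<close>-group over \<open>F\<^sub>p\<close> has a nonzero fixed vector, and the fixed vectors of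
  \<open>F\<^sub>p[G/K]\<close> are the multiples of the sum of all cosets. Hence a homomorphism from a direct sum of
  such modules to \<open>M\<close>, given by fixed vectors \<open>v\<^sub>j\<close> of subgroups \<open>K\<^sub>j\<close>, is injective if and only if the
  traces of the \<open>v\<^sub>j\<close> are linearly independent. Lifting a basis of \<open>M\<^sub>n\<close> adapted to the filtration
  to fixed vectors thus yields \<open>M'\<close>. Conversely, an embedding of the direct sum of \<open>k\<^sub>i\<close> copies of
  \<open>F\<^sub>p[G/G\<^sub>i]\<close> gives \<open>k\<^sub>1 + \<dots> + k\<^sub>r\<close> independent vectors in \<open>M\<^sub>r\<close> for every \<open>r\<close>, and the maximality of \<open>M'\<close>
  follows by Abel summation because the indices \<open>|G : G\<^sub>i|\<close> decrease.
\<close>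

text \<open>The theorem speaks of isomorphisms between modules of different types, while its content
  is linear algebra inside \<open>M\<close>. The passage between the two is
  \<open>orbit_basis\<close>: an isomorphism onto a sum of modules \<open>F_p[G/G_i]\<close> amounts
  to a choice of fixed vectors whose translates, indexed by pairs of a generator and a coset, form a
  basis. That the basis is adapted has a sharp meaning: a vector added in layer \<open>i\<close> has
  to be a trace from \<open>G_i\<close> itself, since an arbitrary element of \<open>M_i\<close>
  need not lift to one fixed vector. Such a choice exists because \<open>M_i\<close> is spanned by
  \<open>M_{i-1}\<close> and these traces. For the last claim, moving along an orbit of a permuted
  basis conjugates the stabilizer until it equals some \<open>G_i\<close>. Thus a permutation module
  is itself a sum of admissible modules and the upper bound applies to all of \<open>M\<close>;
  conversely, equal dimension forces \<open>M' = M\<close>.\<close>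

section \<open>Independent families, and modules of a finite group\<close>

text \<open>Indexed rather than stated for a set: translates by different cosets, or of different
  generators, may coincide in \<open>M\<close>, and that must count as a dependence.\<close>

definition independent_family ::
  "('k::field \<Rightarrow> 'm::ab_group_add \<Rightarrow> 'm) \<Rightarrow> 'i set \<Rightarrow> ('i \<Rightarrow> 'm) \<Rightarrow> bool" where
  "independent_family scale I e \<longleftrightarrow>
     (\<forall>a. (\<Sum>s\<in>I. scale (a s) (e s)) = 0 \<longrightarrow> (\<forall>s\<in>I. a s = 0))"

text \<open>A repeated vector gives a relation with coefficients \<open>1\<close> and
  \<open>-1\<close>, so an independent family is injective. This is the passage to the library's
  bases and dimensions, which concern sets.\<close>

lemma (in vector_space) independent_family_iff:
  assumes I: "finite I"
  shows "independent_family scale I e \<longleftrightarrow> inj_on e I \<and> independent (e ` I)"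
proof (intro iffI conjI)
  assume ind: "independent_family scale I e"
  show inj: "inj_on e I"
  proof (rule inj_onI, rule ccontr)
    fix s t assume st: "s \<in> I" "t \<in> I" "e s = e t" "s \<noteq> t"
    let ?a = "\<lambda>x. if x = s then 1 else if x = t then -1 else (0::'a)"
    have "(\<Sum>x\<in>I. scale (?a x) (e x)) = (\<Sum>x\<in>{s, t}. scale (?a x) (e x))"
      using I st by (intro sum.mono_neutral_right) auto
    also have "\<dots> = 0" using st by simp
    finally have "?a s = 0"
      by (rule ind[unfolded independent_family_def, rule_format, OF _ st(1)])
    then show False by simp
  qed
  show "independent (e ` I)"
  proof (rule independent_if_scalars_zero)
    fix f x assume "(\<Sum>x\<in>e ` I. scale (f x) x) = 0" "x \<in> e ` I"
    moreover from this have "(\<Sum>s\<in>I. scale ((f \<circ> e) s) (e s)) = 0"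
      using inj by (simp add: sum.reindex)
    then have "\<forall>s\<in>I. (f \<circ> e) s = 0" using ind unfolding independent_family_def by blast
    ultimately show "f x = 0" by auto
  qed (use I in simp)
next
  assume *: "inj_on e I \<and> independent (e ` I)"
  show "independent_family scale I e"
    unfolding independent_family_def
  proof (intro allI impI ballI)
    fix a s assume sum: "(\<Sum>s\<in>I. scale (a s) (e s)) = 0" and s: "s \<in> I"
    let ?u = "a \<circ> the_inv_into I e"
    have "(\<Sum>v\<in>e ` I. scale (?u v) v) = (\<Sum>s\<in>I. scale (a s) (e s))"
      using * by (simp add: sum.reindex the_inv_into_f_f)
    then have "?u (e s) = 0"
      using * s sum I by (intro independentD[of "e ` I" "e ` I"]) auto
    then show "a s = 0" using * s by (simp add: the_inv_into_f_f)
  qed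
qed

context kG_module
begin

lemma zero_closed: "0 \<in> carrier M"
  using subspace_carrier by (rule subspace_0)

lemma act_zero: "g \<in> carrier G \<Longrightarrow> act M g 0 = 0"
  using act_smul[OF _ zero_closed, of g 0] by simp

lemma act_sum:
  assumes "g \<in> carrier G" "\<And>s. s \<in> A \<Longrightarrow> e s \<in> carrier M"
  shows "act M g (sum e A) = (\<Sum>s\<in>A. act M g (e s))"
  using assms(2)
proof (induction A rule: infinite_finite_induct)
  case (insert x A)
  then show ?case
    using assms(1) subspace_sum[OF subspace_carrier, of A e] by (simp add: act_add)
qed (use assms(1) in \<open>auto simp: act_zero\<close>)

lemma act_inv_act: "\<lbrakk>g \<in> carrier G; x \<in> carrier M\<rbrakk> \<Longrightarrow> act M (inv g) (act M g x) = x"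
  using act_mult[of "inv g" g x] by (simp add: act_one)

lemma act_act_inv: "\<lbrakk>g \<in> carrier G; x \<in> carrier M\<rbrakk> \<Longrightarrow> act M g (act M (inv g) x) = x"
  using act_mult[of g "inv g" x] by (simp add: act_one)

lemma kG_module_submodule: "kG_submodule G N M \<Longrightarrow> kG_module G (M\<lparr>carrier := N\<rparr>)"
  unfolding kG_submodule_def
  by unfold_locales
    (auto simp: subset_iff act_add act_smul act_one act_mult scale_right_distrib scale_left_distrib)

lemma act_bij_betw_invariant:
  assumes "E \<subseteq> carrier M" "\<And>g x. \<lbrakk>g \<in> carrier G; x \<in> E\<rbrakk> \<Longrightarrow> act M g x \<in> E" "g \<in> carrier G"
  shows "bij_betw (act M g) E E"
  using assms
  by (intro bij_betw_byWitness[where f' = "act M (inv g)"])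
    (auto simp: subset_iff act_inv_act act_act_inv)

text \<open>Makes the orbit-stabilizer theorem of HOL-Algebra available. Its actions take values in
  \<open>BijGroup E\<close>, whose elements are extensional; hence \<open>act M g\<close> is cut
  down to \<open>E\<close>.\<close>

lemma group_action_invariant:
  assumes E: "E \<subseteq> carrier M" "\<And>g x. \<lbrakk>g \<in> carrier G; x \<in> E\<rbrakk> \<Longrightarrow> act M g x \<in> E"
  shows "group_action G E (\<lambda>g. \<lambda>x\<in>E. act M g x)"
proof -
  have Bij: "(\<lambda>x\<in>E. act M g x) \<in> Bij E" if "g \<in> carrier G" for g
    using act_bij_betw_invariant[OF E that] by (simp add: Bij_def cong: bij_betw_cong)
  have "(\<lambda>g. \<lambda>x\<in>E. act M g x) \<in> hom G (BijGroup E)"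
    using Bij E
    by (intro homI) (auto simp: BijGroup_def compose_def fun_eq_iff restrict_def act_mult subset_iff)
  then show ?thesis
    by (simp add: group_action_def group_hom_def group_hom_axioms_def group_BijGroup)
qed

text \<open>As \<open>G\<close> is finite, a finite generating set has finitely many translates, and
  their span is already closed under \<open>G\<close>. Later dimension arguments rest on such a
  finite set, since the type \<open>'m\<close> may be infinite-dimensional.\<close>

lemma finite_spanning_set:
  assumes "finite (carrier G)" "kG_fin_gen G M"
  obtains B where "finite B" "B \<subseteq> carrier M" "span B = carrier M"
proof -
  obtain B where B: "finite B" "B \<subseteq> carrier M"
    "(\<lambda>N. kG_submodule G N M) hull B = carrier M"
    using assms(2) unfolding kG_fin_gen_def by blast
  define C where "C = (\<lambda>(g, b). act M g b) ` (carrier G \<times> B)"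
  have C: "finite C" "C \<subseteq> carrier M"
    using assms(1) B by (auto simp: C_def act_closed subset_iff)
  have sub: "span C \<subseteq> carrier M"
    using C(2) subspace_carrier by (rule span_minimal)
  have "kG_submodule G (span C) M"
    unfolding kG_submodule_def
  proof (intro conjI ballI)
    fix g x assume g: "g \<in> carrier G" and "x \<in> span C"
    from this(2) have "x \<in> carrier M \<and> act M g x \<in> span C"
    proof (induction rule: span_induct_alt)
      case base
      show ?case using g by (simp add: zero_closed act_zero span_zero)
    next
      case (step c x y)
      then obtain h b where x: "x = act M h b" "h \<in> carrier G" "b \<in> B" by (auto simp: C_def)
      have b: "b \<in> carrier M" using x B by auto
      then have "act M g x = (\<lambda>(g, b). act M g b) (g \<otimes> h, b)"
        using x g by (simp add: act_mult)
      moreover have "(g \<otimes> h, b) \<in> carrier G \<times> B" using x g by simp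
      ultimately have "act M g x \<in> C" unfolding C_def by (rule image_eqI)
      moreover have "x \<in> carrier M" using step.hyps C by auto
      ultimately show ?case
        using g step subspace_carrier
        by (auto simp: act_add act_smul subspace_add subspace_scale intro!: span_add span_scale
            intro: span_base)
    qed
    then show "act M g x \<in> span C" ..
  qed (use sub in auto)
  moreover have "B \<subseteq> span C"
  proof
    fix b assume "b \<in> B"
    then have "(\<one>, b) \<in> carrier G \<times> B" "b = (\<lambda>(g, b). act M g b) (\<one>, b)"
      using B by (auto simp: act_one)
    then have "b \<in> C" unfolding C_def by (metis image_eqI)
    then show "b \<in> span C" by (rule span_base)
  qed
  ultimately have "carrier M \<subseteq> span C"
    using B(3) hull_minimal[of B "span C" "\<lambda>N. kG_submodule G N M"] by simp
  with sub have "span C = carrier M" by (rule subset_antisym)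
  then show ?thesis by (rule that[OF C])
qed

end

text \<open>The additive order of a nonzero vector is \<open>p\<close>, so \<open>p\<close> divides the order of a nonzero module;
  all orbits but the singletons have size divisible by \<open>p\<close>, and \<open>0\<close> alone is one singleton.\<close>

lemma p_group_nonzero_fixed_point:
  fixes M :: "('p::prime_card mod_ring, 'g, 'm::ab_group_add) kG_mod"
  assumes M: "kG_module G M" and fin: "finite (carrier M)"
    and p_group: "card (carrier G) = CARD('p) ^ a"
    and r: "r \<in> carrier M" "r \<noteq> 0"
  obtains x where "x \<in> carrier M" "x \<noteq> 0" "\<And>g. g \<in> carrier G \<Longrightarrow> act M g x = x"
proof -
  interpret kG_module G M by fact
  let ?p = "CARD('p)"
  let ?X = "carrier M"
  let ?act = "\<lambda>g. \<lambda>x\<in>?X. act M g x"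
  have p: "prime ?p" by (rule prime_card)
  \<comment> \<open>The additive group of \<open>M\<close> as a HOL-Algebra group, so that
    Lagrange's theorem applies to the line \<open>L\<close> through \<open>r\<close>, which has
    \<open>CARD('p)\<close> elements.\<close>
  define A where "A = \<lparr>carrier = ?X, monoid.mult = (+), one = (0::'m)\<rparr>"
  have grp: "group A"
  proof (rule groupI)
    fix x assume "x \<in> carrier A"
    then show "\<exists>y\<in>carrier A. y \<otimes>\<^bsub>A\<^esub> x = \<one>\<^bsub>A\<^esub>"
      using subspace_neg[OF subspace_carrier, of x]
      by (auto simp: A_def intro!: bexI[of _ "- x"])
  qed (auto simp: A_def add.assoc zero_closed subspace_add[OF subspace_carrier])
  define L where "L = range (\<lambda>c. smul M c r)"
  have "subgroup L A"
  proof (rule group.subgroupI[OF grp])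
    show "L \<subseteq> carrier A" using subspace_scale[OF subspace_carrier r(1)] by (auto simp: A_def L_def)
    show "L \<noteq> {}" by (auto simp: L_def)
    fix x assume "x \<in> L"
    then obtain c where c: "x = smul M c r" by (auto simp: L_def)
    have "inv\<^bsub>A\<^esub> x = smul M (- c) r"
      using c r(1) subspace_scale[OF subspace_carrier r(1)]
        subspace_neg[OF subspace_carrier subspace_scale[OF subspace_carrier r(1)]]
      by (intro group.inv_equality[OF grp]) (simp_all add: A_def)
    then show "inv\<^bsub>A\<^esub> x \<in> L" unfolding L_def by (metis rangeI)
    fix y assume "y \<in> L"
    then obtain d where "y = smul M d r" by (auto simp: L_def)
    then have "x \<otimes>\<^bsub>A\<^esub> y = smul M (c + d) r" using c by (simp add: A_def scale_left_distrib)
    then show "x \<otimes>\<^bsub>A\<^esub> y \<in> L" unfolding L_def by (metis rangeI)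
  qed
  then have "card L dvd Coset.order A" using group.lagrange[OF grp] by (metis dvd_triv_right)
  moreover have "card L = ?p"
    unfolding L_def using r by (subst card_image) (auto intro!: injI)
  ultimately have p_dvd: "?p dvd card ?X" by (simp add: Coset.order_def A_def)
  interpret group_action G ?X ?act
    by (rule group_action_invariant) (auto simp: act_closed)
  let ?O = "orbits G ?X ?act"
  have finO: "finite ?O" using fin by (simp add: orbits_def)
  have orb_sub: "orb \<subseteq> ?X" if "orb \<in> ?O" for orb
    using that orbits_coverture by blast
  have O0: "orbit G ?act 0 \<in> ?O" using zero_closed by (auto simp: orbits_def)
  have orb0: "orbit G ?act 0 = {0}"
    using zero_closed one_closed by (auto simp: orbit_def act_zero intro!: exI[of _ "\<one>\<^bsub>G\<^esub>"])
  have "card ?X = (\<Sum>orb\<in>?O. card orb)"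
    using disjoint_sum[OF fin, of "\<lambda>_. 1 :: nat"] by simp
  also have "\<dots> = 1 + (\<Sum>orb\<in>?O - {orbit G ?act 0}. card orb)"
    using finO O0 by (subst sum.remove) (auto simp: orb0)
  finally have "\<not> ?p dvd (\<Sum>orb\<in>?O - {orbit G ?act 0}. card orb)"
    using p_dvd p by (metis dvd_add_left_iff nat_dvd_1_iff_1 not_prime_1)
  then obtain orb where orb: "orb \<in> ?O" "orb \<noteq> orbit G ?act 0" "\<not> ?p dvd card orb"
    by (metis (lifting) DiffE dvd_sum singletonI)
  then obtain x where x: "x \<in> ?X" "orb = orbit G ?act x" by (auto simp: orbits_def)
  have "card orb dvd ?p ^ a"
    using orbit_stabilizer_theorem[OF x(1)] x(2) p_group by (metis dvd_triv_left Coset.order_def)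
  then obtain i where "card orb = ?p ^ i" using divides_primepow_nat[OF p] by blast
  then have "card orb = 1" using orb(3) by (cases i) auto
  then obtain y where "orb = {y}" by (rule card_1_singletonE)
  then have y: "orb = {x}" using x orbit_refl[OF x(1)] by simp
  show ?thesis
  proof (rule that[OF x(1)])
    show "x \<noteq> 0" using x(2) orb(2) by auto
    show "act M g x = x" if "g \<in> carrier G" for g
    proof -
      have "?act g x \<in> orbit G ?act x" using that by (auto simp: orbit_def)
      then show ?thesis using y x by simp
    qed
  qed
qed

subsection \<open>Translates of a fixed vector\<close>

lemma (in group) l_coset_in_lcosets:
  "\<lbrakk>K \<subseteq> carrier G; g \<in> carrier G; C \<in> lcosets K\<rbrakk> \<Longrightarrow> g <# C \<in> lcosets K"
  by (auto simp: LCOSETS_def lcos_m_assoc)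

lemma (in group) subgroup_in_lcosets: "subgroup K G \<Longrightarrow> K \<in> lcosets K"
  using lcos_mult_one[of K] by (force simp: LCOSETS_def subgroup.subset)

lemma (in group) finite_lcosets: "finite (carrier G) \<Longrightarrow> finite (lcosets K)"
  by (simp add: LCOSETS_def)

text \<open>The choice of the representative is immaterial if \<open>v\<close> is fixed by \<open>K\<close> and \<open>C\<close> is a left coset of \<open>K\<close>.\<close>

definition coset_act :: "('k, 'g, 'm) kG_mod \<Rightarrow> 'g set \<Rightarrow> 'm \<Rightarrow> 'm" where
  "coset_act M C v = act M (SOME g. g \<in> C) v"

context kG_module
begin

lemma fixed_points_carrier: "v \<in> fixed_points M K \<Longrightarrow> v \<in> carrier M"
  by (simp add: fixed_points_def)

lemma coset_act_l_coset:
  assumes K: "subgroup K G" and v: "v \<in> fixed_points M K" and g: "g \<in> carrier G"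
  shows "coset_act M (g <# K) v = act M g v"
proof -
  have "(SOME x. x \<in> g <# K) \<in> g <# K"
    using lcos_self[OF g K] by (rule someI)
  then obtain h where h: "h \<in> K" "(SOME x. x \<in> g <# K) = g \<otimes> h"
    by (auto simp: l_coset_def)
  then show ?thesis
    using v g subgroup.mem_carrier[OF K h(1)]
    by (simp add: coset_act_def act_mult fixed_points_def)
qed

lemma coset_act_self:
  assumes "subgroup K G" "v \<in> fixed_points M K"
  shows "coset_act M K v = v"
  using coset_act_l_coset[OF assms one_closed] assms subgroup.subset[OF assms(1)]
  by (simp add: lcos_mult_one act_one fixed_points_carrier)

lemma coset_act_closed:
  assumes "subgroup K G" "v \<in> fixed_points M K" "C \<in> lcosets K"
  shows "coset_act M C v \<in> carrier M"
  using assms(3) coset_act_l_coset[OF assms(1,2)] fixed_points_carrier[OF assms(2)]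
  by (auto simp: LCOSETS_def act_closed)

lemma act_coset_act:
  assumes "subgroup K G" "v \<in> fixed_points M K" "C \<in> lcosets K" "g \<in> carrier G"
  shows "act M g (coset_act M C v) = coset_act M (g <# C) v"
proof -
  obtain h where h: "h \<in> carrier G" "C = h <# K" using assms(3) by (auto simp: LCOSETS_def)
  then have "g <# C = (g \<otimes> h) <# K"
    using assms(4) subgroup.subset[OF assms(1)] by (simp add: lcos_m_assoc)
  then show ?thesis
    using assms h by (simp add: coset_act_l_coset act_mult fixed_points_carrier)
qed

text \<open>Left multiplication permutes cosets but not a transversal, so the proof works with sums
  over cosets. The two sums agree because a transversal meets each coset once and the translate of a
  fixed vector depends only on the coset.\<close>

lemma sum_coset_act_transversal:
  assumes K: "subgroup K G" and v: "v \<in> fixed_points M K" and T: "left_transversal G K T"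
  shows "(\<Sum>C\<in>lcosets K. coset_act M C v) = (\<Sum>t\<in>T. act M t v)"
proof -
  have TG: "T \<subseteq> carrier G" and ex1: "\<And>C. C \<in> lcosets K \<Longrightarrow> \<exists>!t. t \<in> T \<inter> C"
    using T by (auto simp: left_transversal_def)
  have mem: "t <# K \<in> lcosets K" "t \<in> t <# K" if "t \<in> T" for t
    using that TG lcos_self[OF _ K] by (auto simp: LCOSETS_def)
  have "bij_betw (\<lambda>t. t <# K) T (lcosets K)"
    unfolding bij_betw_def
  proof (intro conjI inj_onI subset_antisym subsetI)
    fix s t assume "s \<in> T" "t \<in> T" "s <# K = t <# K"
    then show "s = t" using ex1[OF mem(1)] mem by (metis IntI)
  next
    fix C assume C: "C \<in> lcosets K"
    then obtain t where t: "t \<in> T" "t \<in> C" using ex1 by blast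
    moreover obtain g where "g \<in> carrier G" "C = g <# K" using C by (auto simp: LCOSETS_def)
    ultimately have "C = t <# K" using l_repr_independence K by blast
    then show "C \<in> (\<lambda>t. t <# K) ` T" using t by blast
  qed (use mem in auto)
  then have "(\<Sum>C\<in>lcosets K. coset_act M C v) = (\<Sum>t\<in>T. coset_act M (t <# K) v)"
    by (rule sum.reindex_bij_betw[symmetric])
  also have "\<dots> = (\<Sum>t\<in>T. act M t v)"
    using TG by (intro sum.cong) (auto simp: coset_act_l_coset[OF K v])
  finally show ?thesis .
qed

end

text \<open>The linear relations between the translates form a submodule of a permutation module; if it
  were nonzero, it would contain a nonzero fixed vector, whose coefficients are
  constant on orbits and hence give a relation between the traces.\<close>

lemma independent_translates_iff_independent_traces:
  fixes M :: "('p::prime_card mod_ring, 'g, 'm::ab_group_add) kG_mod"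
    and G :: "('g, 'b) monoid_scheme" (structure)
    and J :: "'j set"
  assumes M: "kG_module G M" and fin: "finite (carrier G)"
    and p_group: "card (carrier G) = CARD('p) ^ a"
    and J: "finite J" and K: "\<And>j. j \<in> J \<Longrightarrow> subgroup (K j) G"
    and v: "\<And>j. j \<in> J \<Longrightarrow> v j \<in> fixed_points M (K j)"
  shows "independent_family (smul M) (SIGMA j:J. lcosets (K j)) (\<lambda>(j, C). coset_act M C (v j)) \<longleftrightarrow>
         independent_family (smul M) J (\<lambda>j. \<Sum>C\<in>lcosets (K j). coset_act M C (v j))"
proof -
  interpret kG_module G M by fact
  define S where "S = (SIGMA j:J. lcosets (K j))"
  define e where "e = (\<lambda>(j, C). coset_act M C (v j))"
  have S: "finite S" using J finite_lcosets[OF fin] by (auto simp: S_def)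
  have e_closed: "e s \<in> carrier M" if "s \<in> S" for s
    using that coset_act_closed[OF K v] by (auto simp: S_def e_def)
  \<comment> \<open>Coefficients that are constant on each summand \<open>j\<close> turn a relation
    between translates into one between traces; both directions of the equivalence use this.\<close>
  have const: "(\<Sum>s\<in>S. smul M (b (fst s)) (e s)) =
      (\<Sum>j\<in>J. smul M (b j) (\<Sum>C\<in>lcosets (K j). coset_act M C (v j)))" for b
  proof -
    have "(\<Sum>s\<in>S. smul M (b (fst s)) (e s)) =
        (\<Sum>(j, C)\<in>S. smul M (b j) (coset_act M C (v j)))"
      by (intro sum.cong) (auto simp: e_def)
    also have "\<dots> = (\<Sum>j\<in>J. \<Sum>C\<in>lcosets (K j). smul M (b j) (coset_act M C (v j)))"
      unfolding S_def using J finite_lcosets[OF fin] by (intro sum.Sigma[symmetric]) auto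
    finally show ?thesis by (simp add: scale_sum_right)
  qed
  have "independent_family (smul M) S e \<longleftrightarrow>
        independent_family (smul M) J (\<lambda>j. \<Sum>C\<in>lcosets (K j). coset_act M C (v j))"
  proof
    assume ind: "independent_family (smul M) S e"
    show "independent_family (smul M) J (\<lambda>j. \<Sum>C\<in>lcosets (K j). coset_act M C (v j))"
      unfolding independent_family_def
    proof (intro allI impI ballI)
      fix b j
      assume "(\<Sum>j\<in>J. smul M (b j) (\<Sum>C\<in>lcosets (K j). coset_act M C (v j))) = 0" and j: "j \<in> J"
      then have "(\<Sum>s\<in>S. smul M ((b \<circ> fst) s) (e s)) = 0" using const[of b] by simp
      moreover have "(j, K j) \<in> S" using j K by (auto simp: S_def subgroup_in_lcosets)
      ultimately have "(b \<circ> fst) (j, K j) = 0"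
        using ind unfolding independent_family_def by blast
      then show "b j = 0" by simp
    qed
  next
    assume ind: "independent_family (smul M) J (\<lambda>j. \<Sum>C\<in>lcosets (K j). coset_act M C (v j))"
    \<comment> \<open>\<open>G\<close> acts on the index set by translating the coset, which makes
      \<open>e\<close> equivariant. Consequently \<open>F\<close> below is the equivariant linear
      map from the permutation module on \<open>S\<close> that sends the basis vector
      \<open>s\<close> to \<open>e s\<close>.\<close>
    define \<phi> where "\<phi> = (\<lambda>g (j :: 'j, C). (j, g <#\<^bsub>G\<^esub> C))"
    have \<phi>_closed: "\<phi> g s \<in> S" if "g \<in> carrier G" "s \<in> S" for g s
      using that l_coset_in_lcosets[OF subgroup.subset[OF K]] by (auto simp: S_def \<phi>_def)
    have sub: "C \<subseteq> carrier G" if "(j, C) \<in> S" for j C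
      using that subgroup.lcosets_carrier[OF K is_group] by (auto simp: S_def)
    have \<phi>_one: "\<phi> \<one> s = s" if "s \<in> S" for s
      using that sub by (cases s) (auto simp: \<phi>_def lcos_mult_one)
    have \<phi>_mult: "\<phi> (g \<otimes> h) s = \<phi> g (\<phi> h s)" if "g \<in> carrier G" "h \<in> carrier G" "s \<in> S" for g h s
      using that sub by (cases s) (auto simp: \<phi>_def lcos_m_assoc)
    have \<phi>_inj: "\<phi> g s = \<phi> g t \<longleftrightarrow> s = t" if "g \<in> carrier G" "s \<in> S" "t \<in> S" for g s t
      using that \<phi>_mult[of "inv g" g] \<phi>_one by (metis inv_closed l_inv)
    have e_\<phi>: "e (\<phi> g s) = act M g (e s)" if "g \<in> carrier G" "s \<in> S" for g s
      using that act_coset_act[OF K v] by (auto simp: e_def \<phi>_def S_def)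
    define P where "P = (perm_module S \<phi> :: ('p mod_ring, 'g, ('j \<times> 'g set) \<Rightarrow>\<^sub>0 'p mod_ring) kG_mod)"
    interpret P: kG_module G P
      unfolding P_def by (rule kG_module_perm_module) (auto simp: \<phi>_closed \<phi>_one \<phi>_mult)
    have P_carrier: "f \<in> carrier P \<longleftrightarrow> Poly_Mapping.keys f \<subseteq> S" for f
      by (simp add: P_def perm_module_def)
    have P_smul: "Poly_Mapping.lookup (smul P c f) s = c * Poly_Mapping.lookup f s" for c f s
      by (simp add: P_def perm_module_def Poly_Mapping.map.rep_eq when_def)
    have P_act: "act P g f = (\<Sum>t\<in>Poly_Mapping.keys f.
        Poly_Mapping.single (\<phi> g t) (Poly_Mapping.lookup f t))" for g f
      by (simp add: P_def perm_module_def)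
    define F where "F = (\<lambda>f. \<Sum>s\<in>S. smul M (Poly_Mapping.lookup f s) (e s))"
    have F_add: "F (f + f') = F f + F f'" for f f'
      by (simp add: F_def lookup_add scale_left_distrib sum.distrib)
    have F_smul: "F (smul P c f) = smul M c (F f)" for c f
      by (simp add: F_def P_smul scale_sum_right)
    have F_keys: "F f = (\<Sum>t\<in>Poly_Mapping.keys f. smul M (Poly_Mapping.lookup f t) (e t))"
      if "f \<in> carrier P" for f
      unfolding F_def
      by (rule sum.mono_neutral_right) (use that S in \<open>auto simp: P_carrier in_keys_iff\<close>)
    have F_act: "F (act P g f) = act M g (F f)" if g: "g \<in> carrier G" and f: "f \<in> carrier P" for g f
    proof -
      have keys: "t \<in> S" if "t \<in> Poly_Mapping.keys f" for t using that f P_carrier by blast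
      have "F (act P g f) = (\<Sum>s\<in>S. \<Sum>t\<in>Poly_Mapping.keys f.
          smul M (if s = \<phi> g t then Poly_Mapping.lookup f t else 0) (e s))"
        by (simp add: F_def P_act lookup_sum lookup_single when_def scale_sum_left eq_commute)
      also have "\<dots> = (\<Sum>t\<in>Poly_Mapping.keys f. \<Sum>s\<in>S.
          if s = \<phi> g t then smul M (Poly_Mapping.lookup f t) (e s) else 0)"
        by (subst sum.swap) (auto intro!: sum.cong)
      also have "\<dots> = (\<Sum>t\<in>Poly_Mapping.keys f. smul M (Poly_Mapping.lookup f t) (e (\<phi> g t)))"
        using S keys g by (intro sum.cong) (auto simp: sum.delta \<phi>_closed)
      also have "\<dots> = (\<Sum>t\<in>Poly_Mapping.keys f. act M g (smul M (Poly_Mapping.lookup f t) (e t)))"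
        using keys g by (intro sum.cong) (auto simp: e_\<phi> act_smul e_closed)
      also have "\<dots> = act M g (F f)"
        using keys g subspace_scale[OF subspace_carrier] f
        by (subst act_sum[symmetric]) (auto simp: e_closed F_keys)
      finally show ?thesis .
    qed
    define N where "N = {f \<in> carrier P. F f = 0}"
    have "kG_submodule G N P"
      unfolding kG_submodule_def
    proof (intro conjI ballI P.subspaceI)
      show "0 \<in> N" using P.zero_closed by (simp add: N_def F_def)
    qed (use P.subspace_carrier in \<open>auto simp: N_def F_add F_smul F_act act_zero P.act_closed
          intro: P.subspace_add P.subspace_scale\<close>)
    then have N: "kG_module G (P\<lparr>carrier := N\<rparr>)" by (rule P.kG_module_submodule)
    \<comment> \<open>The relations, that is, the kernel \<open>N\<close> of \<open>F\<close>, are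
      functions on a finite set with values in a finite field; so \<open>N\<close> is finite and the
      orbit count applies to it.\<close>
    have "finite {a. \<forall>s. (s \<in> S \<longrightarrow> a s \<in> (UNIV :: 'p mod_ring set)) \<and> (s \<notin> S \<longrightarrow> a s = 0)}"
      using S by (intro finite_set_of_finite_funs) auto
    moreover have "Poly_Mapping.lookup ` N \<subseteq>
        {a. \<forall>s. (s \<in> S \<longrightarrow> a s \<in> (UNIV :: 'p mod_ring set)) \<and> (s \<notin> S \<longrightarrow> a s = 0)}"
      by (auto simp: N_def P_carrier in_keys_iff)
    ultimately have "finite (Poly_Mapping.lookup ` N)" by (rule rev_finite_subset)
    then have finN: "finite N"
      by (rule finite_imageD) (auto intro!: inj_onI poly_mapping_eqI)
    show "independent_family (smul M) S e"
      unfolding independent_family_def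
    proof (intro allI impI ballI, rule ccontr)
      fix b s assume sum: "(\<Sum>s\<in>S. smul M (b s) (e s)) = 0" and s: "s \<in> S" "b s \<noteq> 0"
      define r where "r = Abs_poly_mapping (\<lambda>t. if t \<in> S then b t else 0)"
      have r: "Poly_Mapping.lookup r = (\<lambda>t. if t \<in> S then b t else 0)"
        unfolding r_def using S by (intro lookup_Abs_poly_mapping) (rule finite_subset[of _ S], auto)
      have "r \<in> N" using sum by (auto simp: N_def P_carrier F_def r in_keys_iff split: if_splits)
      moreover have "r \<noteq> 0"
      proof
        assume "r = 0"
        then have "Poly_Mapping.lookup r s = 0" by simp
        then show False using s r by simp
      qed
      ultimately obtain x where x: "x \<in> N" "x \<noteq> 0" and fix_x: "\<And>g. g \<in> carrier G \<Longrightarrow> act P g x = x"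
        using p_group_nonzero_fixed_point[OF N _ p_group, of r] finN by auto
      have keys: "t \<in> S" if "t \<in> Poly_Mapping.keys x" for t using that x P_carrier N_def by blast
      have inv: "Poly_Mapping.lookup x (\<phi> g t) = Poly_Mapping.lookup x t"
        if "g \<in> carrier G" "t \<in> S" for g t
      proof -
        have "Poly_Mapping.lookup x (\<phi> g t) = Poly_Mapping.lookup (act P g x) (\<phi> g t)"
          using fix_x that by simp
        also have "\<dots> = (\<Sum>u\<in>Poly_Mapping.keys x. if u = t then Poly_Mapping.lookup x u else 0)"
          unfolding P_act lookup_sum using that keys
          by (intro sum.cong) (auto simp: lookup_single when_def \<phi>_inj)
        also have "\<dots> = Poly_Mapping.lookup x t" by (simp add: sum.delta in_keys_iff)
        finally show ?thesis .
      qed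
      \<comment> \<open>Every \<open>(j, C)\<close> lies in the orbit of \<open>(j, K j)\<close>, so
        an invariant coefficient depends on \<open>j\<close> alone.\<close>
      have const_x: "Poly_Mapping.lookup x t = Poly_Mapping.lookup x (fst t, K (fst t))"
        if tS: "t \<in> S" for t
      proof -
        obtain j C where t: "t = (j, C)" "j \<in> J" "C \<in> lcosets (K j)" using tS by (auto simp: S_def)
        then obtain g where g: "g \<in> carrier G" "C = g <# K j" by (auto simp: LCOSETS_def)
        have "(j, K j) \<in> S" using t K by (auto simp: S_def subgroup_in_lcosets)
        from inv[OF g(1) this] show ?thesis using t g by (simp add: \<phi>_def)
      qed
      define c where "c = (\<lambda>j. Poly_Mapping.lookup x (j, K j))"
      have "0 = (\<Sum>t\<in>S. smul M (Poly_Mapping.lookup x t) (e t))"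
        using x(1) by (simp add: N_def F_def)
      also have "\<dots> = (\<Sum>t\<in>S. smul M (c (fst t)) (e t))"
        by (intro sum.cong) (simp_all add: const_x c_def)
      finally have "\<forall>j\<in>J. c j = 0"
        using ind const[of c] unfolding independent_family_def by metis
      then have "Poly_Mapping.lookup x t = 0" if "t \<in> S" for t
      proof -
        have "fst t \<in> J" using that by (auto simp: S_def)
        then show ?thesis using const_x[OF that] \<open>\<forall>j\<in>J. c j = 0\<close> by (simp add: c_def)
      qed
      then have "x = 0" using keys by (intro poly_mapping_eqI) (auto simp: in_keys_iff)
      then show False using x(2) by simp
    qed
  qed
  then show ?thesis by (simp add: S_def e_def)
qed

subsection \<open>Bases consisting of orbits\<close>

text \<open>A sum of modules \<open>k[G/K j]\<close>, \<open>j \<in> J\<close>, in coordinates: \<open>v j\<close> is the image of the trivial coset \<open>K j\<close>.\<close>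

definition orbit_basis ::
  "('g, 'b) monoid_scheme \<Rightarrow> ('k::field, 'g, 'm::ab_group_add) kG_mod
     \<Rightarrow> 'j set \<Rightarrow> ('j \<Rightarrow> 'g set) \<Rightarrow> ('j \<Rightarrow> 'm) \<Rightarrow> bool" where
  "orbit_basis G M J K v \<longleftrightarrow>
     finite J \<and> (\<forall>j\<in>J. v j \<in> fixed_points M (K j)) \<and>
     independent_family (smul M) (SIGMA j:J. lcosets\<^bsub>G\<^esub> (K j)) (\<lambda>(j, C). coset_act M C (v j)) \<and>
     module.span (smul M) ((\<lambda>(j, C). coset_act M C (v j)) ` (SIGMA j:J. lcosets\<^bsub>G\<^esub> (K j))) = carrier M"

text \<open>Both bases are indexed by the same set of pairs, and \<open>G\<close> moves both
  families by the same rule on indices. The linear map matching the bases is therefore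
  equivariant.\<close>

lemma kG_iso_if_orbit_bases:
  fixes M :: "('k::field, 'g, 'm::ab_group_add) kG_mod"
    and N :: "('k, 'g, 'n::ab_group_add) kG_mod"
    and G :: "('g, 'b) monoid_scheme" (structure)
  assumes M: "kG_module G M" and N: "kG_module G N" and fin: "finite (carrier G)"
    and K: "\<And>j. j \<in> J \<Longrightarrow> subgroup (K j) G"
    and v: "orbit_basis G M J K v" and w: "orbit_basis G N J K w"
  shows "kG_iso G M N"
proof -
  interpret M: kG_module G M by fact
  interpret N: kG_module G N by fact
  interpret vector_space_pair "smul M" "smul N" by unfold_locales
  define S where "S = (SIGMA j:J. lcosets (K j))"
  define e where "e = (\<lambda>(j, C). coset_act M C (v j))"
  define d where "d = (\<lambda>(j, C). coset_act N C (w j))"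
  have S: "finite S"
    using v M.finite_lcosets[OF fin] by (auto simp: S_def orbit_basis_def)
  have e: "inj_on e S" "M.independent (e ` S)" "M.span (e ` S) = carrier M"
    using v M.independent_family_iff[OF S] by (auto simp: orbit_basis_def S_def e_def)
  have d: "inj_on d S" "N.independent (d ` S)" "N.span (d ` S) = carrier N"
    using w N.independent_family_iff[OF S] by (auto simp: orbit_basis_def S_def d_def)
  have vK: "v j \<in> fixed_points M (K j)" and wK: "w j \<in> fixed_points N (K j)" if "j \<in> J" for j
    using that v w by (auto simp: orbit_basis_def)
  obtain f where f: "Vector_Spaces.linear (smul M) (smul N) f"
    "\<forall>x\<in>e ` S. f x = (d \<circ> the_inv_into S e) x"
    using linear_independent_extend[OF e(2)] by blast
  have fe: "f (e s) = d s" if "s \<in> S" for s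
    using f(2) that e(1) by (simp add: the_inv_into_f_f)
  interpret f: Vector_Spaces.linear "smul M" "smul N" f by (rule f(1))
  have im: "f ` e ` S = d ` S" using fe by (auto simp: image_image)
  have "inj_on f (e ` S)" using d(1) fe by (auto simp: inj_on_def)
  then have inj: "inj_on f (carrier M)"
    using f.inj_on_span_independent_image[of "e ` S"] d(2) im e(3) by simp
  have surj: "f ` carrier M = carrier N"
    using f.span_image[of "e ` S"] im d(3) e(3) by simp
  have act: "f (act M g x) = act N g (f x)" if g: "g \<in> carrier G" and "x \<in> carrier M" for g x
  proof -
    have "x \<in> M.span (e ` S)" using that e(3) by simp
    then have "x \<in> carrier M \<and> f (act M g x) = act N g (f x)"
    proof (induction rule: M.span_induct_alt)
      case base
      show ?case using g by (simp add: M.zero_closed M.act_zero N.act_zero)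
    next
      case (step c x y)
      then obtain j C where s: "x = e (j, C)" "j \<in> J" "C \<in> lcosets (K j)" by (auto simp: S_def)
      have sS: "(j, C) \<in> S" "(j, g <#\<^bsub>G\<^esub> C) \<in> S"
        using s g M.l_coset_in_lcosets[OF subgroup.subset[OF K]] by (auto simp: S_def)
      have x: "x \<in> carrier M" using M.coset_act_closed[OF K vK] s by (simp add: e_def)
      have "act M g x = e (j, g <#\<^bsub>G\<^esub> C)"
        using s g M.act_coset_act[OF K vK] by (simp add: e_def)
      moreover have "act N g (d (j, C)) = d (j, g <#\<^bsub>G\<^esub> C)"
        using s g N.act_coset_act[OF K wK] by (simp add: d_def)
      ultimately have "f (act M g x) = act N g (f x)" using sS s fe by simp
      moreover have "smul M c x \<in> carrier M" using x by (rule M.subspace_scale[OF M.subspace_carrier])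
      moreover have "smul N c (f x) \<in> carrier N" "f x \<in> carrier N" "f y \<in> carrier N"
        using x step surj N.subspace_scale[OF N.subspace_carrier] by blast+
      ultimately show ?case
        using g x step M.subspace_add[OF M.subspace_carrier]
        by (simp add: M.act_add M.act_smul N.act_add N.act_smul f.add f.scale)
    qed
    then show ?thesis ..
  qed
  show ?thesis
    unfolding kG_iso_def bij_betw_def using inj surj act
    by (intro exI[of _ f]) (simp add: f.add f.scale)
qed

text \<open>Needed because the standard generators are known in the direct sum and have to be
  transported from there back into the submodule.\<close>

lemma kG_iso_sym:
  assumes M: "kG_module G M" and iso: "kG_iso G M N"
  shows "kG_iso G N M"
proof -
  interpret M: kG_module G M by fact
  obtain f where bij: "bij_betw f (carrier M) (carrier N)"
    and add: "\<And>x y. \<lbrakk>x \<in> carrier M; y \<in> carrier M\<rbrakk> \<Longrightarrow> f (x + y) = f x + f y"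
    and smul: "\<And>c x. x \<in> carrier M \<Longrightarrow> f (smul M c x) = smul N c (f x)"
    and act: "\<And>g x. \<lbrakk>g \<in> carrier G; x \<in> carrier M\<rbrakk> \<Longrightarrow> f (act M g x) = act N g (f x)"
    using iso unfolding kG_iso_def by metis
  define h where "h = the_inv_into (carrier M) f"
  have h: "h y \<in> carrier M" "f (h y) = y" if "y \<in> carrier N" for y
    using that bij unfolding h_def bij_betw_def
    by (auto intro: the_inv_into_into f_the_inv_into_f)
  have hI: "h y = x" if "x \<in> carrier M" "f x = y" for x y
    using that bij by (auto simp: h_def bij_betw_def the_inv_into_f_f)
  show ?thesis
    unfolding kG_iso_def
  proof (intro exI[of _ h] conjI allI ballI)
    show "bij_betw h (carrier N) (carrier M)"
      unfolding h_def by (rule bij_betw_the_inv_into[OF bij])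
  qed (auto intro!: hI simp: h add smul act M.act_closed M.subspace_add[OF M.subspace_carrier]
      M.subspace_scale[OF M.subspace_carrier])
qed

text \<open>The images of the generators serve. The isomorphism is additive and homogeneous on
  \<open>carrier M\<close> only, so sums and spans are pushed through it by hand rather than by the
  theory of linear maps.\<close>

lemma orbit_basis_if_kG_iso:
  fixes M :: "('k::field, 'g, 'm::ab_group_add) kG_mod"
    and N :: "('k, 'g, 'n::ab_group_add) kG_mod"
    and G :: "('g, 'b) monoid_scheme" (structure)
  assumes M: "kG_module G M" and N: "kG_module G N"
    and K: "\<And>j. j \<in> J \<Longrightarrow> subgroup (K j) G"
    and v: "orbit_basis G M J K v" and iso: "kG_iso G M N"
  obtains w where "orbit_basis G N J K w"
proof -
  interpret M: kG_module G M by fact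
  interpret N: kG_module G N by fact
  obtain f where bij: "bij_betw f (carrier M) (carrier N)"
    and f_add: "\<And>x y. \<lbrakk>x \<in> carrier M; y \<in> carrier M\<rbrakk> \<Longrightarrow> f (x + y) = f x + f y"
    and f_smul: "\<And>c x. x \<in> carrier M \<Longrightarrow> f (smul M c x) = smul N c (f x)"
    and f_act: "\<And>g x. \<lbrakk>g \<in> carrier G; x \<in> carrier M\<rbrakk> \<Longrightarrow> f (act M g x) = act N g (f x)"
    using iso unfolding kG_iso_def by metis
  have f_closed: "f x \<in> carrier N" if "x \<in> carrier M" for x
    using that bij by (auto simp: bij_betw_def)
  have f_0: "f 0 = 0" using f_smul[of 0 0] M.zero_closed by simp
  have f_sum: "f (sum x A) = (\<Sum>i\<in>A. f (x i))" if "\<And>i. i \<in> A \<Longrightarrow> x i \<in> carrier M"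
    for x :: "'j \<times> 'g set \<Rightarrow> 'm" and A
    using that
  proof (induction A rule: infinite_finite_induct)
    case (insert i A)
    then show ?case using M.subspace_sum[OF M.subspace_carrier, of A x] by (simp add: f_add)
  qed (use f_0 in auto)
  define S where "S = (SIGMA j:J. lcosets (K j))"
  define e where "e = (\<lambda>(j, C). coset_act M C (v j))"
  define d where "d = (\<lambda>(j, C). coset_act N C (f (v j)))"
  have vK: "v j \<in> fixed_points M (K j)" if "j \<in> J" for j
    using that v by (auto simp: orbit_basis_def)
  have fvK: "f (v j) \<in> fixed_points N (K j)" if "j \<in> J" for j
    using vK[OF that] subgroup.mem_carrier[OF K[OF that]] f_closed
    by (auto simp: fixed_points_def f_act[symmetric])
  have e_closed: "e s \<in> carrier M" if "s \<in> S" for s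
    using that M.coset_act_closed[OF K vK] by (auto simp: S_def e_def)
  have fe: "f (e s) = d s" if "s \<in> S" for s
  proof -
    obtain j g where s: "s = (j, g <#\<^bsub>G\<^esub> K j)" "j \<in> J" "g \<in> carrier G"
      using \<open>s \<in> S\<close> by (auto simp: S_def LCOSETS_def)
    then show ?thesis
      using M.coset_act_l_coset[OF K vK] N.coset_act_l_coset[OF K fvK] M.fixed_points_carrier[OF vK]
      by (simp add: e_def d_def f_act)
  qed
  have ind: "independent_family (smul N) S d"
    unfolding independent_family_def
  proof (intro allI impI)
    fix a assume "(\<Sum>s\<in>S. smul N (a s) (d s)) = 0"
    moreover have "(\<Sum>s\<in>S. smul N (a s) (d s)) = f (\<Sum>s\<in>S. smul M (a s) (e s))"
      using e_closed M.subspace_scale[OF M.subspace_carrier]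
      by (subst f_sum) (auto simp: f_smul fe)
    moreover have "(\<Sum>s\<in>S. smul M (a s) (e s)) \<in> carrier M"
      using e_closed by (intro M.subspace_sum[OF M.subspace_carrier] M.subspace_scale[OF M.subspace_carrier])
    ultimately have "(\<Sum>s\<in>S. smul M (a s) (e s)) = 0"
      using bij f_0 M.zero_closed by (metis bij_betw_imp_inj_on inj_onD)
    moreover have "independent_family (smul M) S e"
      using v by (simp add: orbit_basis_def S_def e_def)
    ultimately show "\<forall>s\<in>S. a s = 0" unfolding independent_family_def by blast
  qed
  have span_e: "M.span (e ` S) = carrier M" using v by (simp add: orbit_basis_def S_def e_def)
  have "N.span (d ` S) = carrier N"
  proof (rule subset_antisym)
    show "N.span (d ` S) \<subseteq> carrier N"
      using fe e_closed f_closed by (intro N.span_minimal N.subspace_carrier) (metis image_subsetI)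
    show "carrier N \<subseteq> N.span (d ` S)"
    proof
      fix y assume "y \<in> carrier N"
      then obtain x where x: "x \<in> M.span (e ` S)" "y = f x"
        using bij span_e by (auto simp: bij_betw_def)
      from x(1) have "x \<in> carrier M \<and> f x \<in> N.span (d ` S)"
      proof (induction rule: M.span_induct_alt)
        case base
        show ?case by (simp add: f_0 N.span_zero M.zero_closed)
      next
        case (step c x y)
        then obtain s where "s \<in> S" "x = e s" by auto
        then have "x \<in> carrier M" "f x \<in> N.span (d ` S)"
          using e_closed fe by (auto intro: N.span_base)
        moreover from this(1) have "smul M c x \<in> carrier M"
          by (rule M.subspace_scale[OF M.subspace_carrier])
        ultimately show ?case
          using step M.subspace_add[OF M.subspace_carrier]
          by (simp add: f_add f_smul N.span_add N.span_scale)
      qed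
      then show "y \<in> N.span (d ` S)" using x by simp
    qed
  qed
  then have "orbit_basis G N J K (f \<circ> v)"
    using v ind fvK unfolding orbit_basis_def S_def d_def by simp
  then show ?thesis by (rule that)
qed

section \<open>The standard coordinates of a direct sum of coset modules\<close>

text \<open>For \<open>x = 0\<close> the left side is \<open>0\<close>, whereas \<open>F i 0\<close>
  may be nonzero.\<close>

lemma mapp_single:
  "x \<noteq> 0 \<Longrightarrow> Poly_Mapping.mapp F (Poly_Mapping.single i x) = Poly_Mapping.single i (F i x)"
  by (rule poly_mapping_eqI) (auto simp: lookup_mapp lookup_single when_def)

lemma single_eq_0_iff: "Poly_Mapping.single i x = 0 \<longleftrightarrow> x = 0"
  by (metis lookup_single_eq lookup_zero single_zero)

text \<open>\<open>kG_module_direct_sum\<close> asks for a vector space at every index, also where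
  \<open>H i\<close> is not known to be a subgroup. The scalars do not depend on the subgroup, so
  the case of \<open>carrier G\<close> settles all of them.\<close>

lemma smul_coset_module:
  "smul (coset_module G H) = smul (coset_module G K)"
  by (simp add: coset_module_def perm_module_def)

lemma smul_copies: "smul (copies k V) = smul (copies l V)"
  by (simp add: copies_def direct_sum_def)

lemma kG_module_direct_sum_copies:
  fixes G :: "('g, 'b) monoid_scheme"
  assumes G: "group G" and H: "\<And>i. i \<in> I \<Longrightarrow> subgroup (H i) G"
  shows "kG_module G (direct_sum I (\<lambda>i. copies (k i)
    (coset_module G (H i) :: ('k::field, 'g, 'g set \<Rightarrow>\<^sub>0 'k) kG_mod)))"
proof -
  let ?V = "\<lambda>H. coset_module G H :: ('k::field, 'g, 'g set \<Rightarrow>\<^sub>0 'k) kG_mod"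
  interpret G: group G by fact
  have vs: "vector_space (smul (?V K))" for K
    using kG_module_coset_module[OF G G.subgroup_self]
    by (subst smul_coset_module[of _ _ "carrier G"]) (auto simp: kG_module_def)
  \<comment> \<open>An empty sum is a module for any set \<open>K\<close>, and scalar multiplication
    on \<open>copies\<close> does not see the number of copies; this gives the vector space axioms
    for every \<open>l\<close>.\<close>
  have "kG_module G (copies 0 (?V K))" for K
    unfolding copies_def using G vs by (rule kG_module_direct_sum) simp
  then have vs': "vector_space (smul (copies l (?V K)))" for l K
    by (subst smul_copies[of _ _ 0]) (auto simp: kG_module_def)
  have "kG_module G (copies l (?V K))" if "subgroup K G" for l K
    unfolding copies_def using G vs kG_module_coset_module[OF G that] by (rule kG_module_direct_sum)
  then show ?thesis using H by (intro kG_module_direct_sum G vs') auto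
qed

text \<open>The generator numbered \<open>(i, l)\<close> is the trivial coset in copy
  \<open>l\<close> of summand \<open>i\<close>; its translates are the standard basis vectors of
  that copy.\<close>

lemma orbit_basis_direct_sum_copies:
  fixes G :: "('g, 'b) monoid_scheme" (structure)
    and I :: "'i set"
  assumes G: "group G" and fin: "finite (carrier G)" and I: "finite I"
    and H: "\<And>i. i \<in> I \<Longrightarrow> subgroup (H i) G"
  shows "orbit_basis G
    (direct_sum I (\<lambda>i. copies (k i) (coset_module G (H i) :: ('k::field, 'g, 'g set \<Rightarrow>\<^sub>0 'k) kG_mod)))
    (SIGMA i:I. {..<k i}) (H \<circ> fst)
    (\<lambda>(i, l). Poly_Mapping.single i (Poly_Mapping.single l (Poly_Mapping.single (H i) 1)))"
proof -
  let ?V = "\<lambda>i. coset_module G (H i) :: ('k::field, 'g, 'g set \<Rightarrow>\<^sub>0 'k) kG_mod"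
  define D where "D = direct_sum I (\<lambda>i. copies (k i) (?V i))"
  interpret kG_module G D
    unfolding D_def by (rule kG_module_direct_sum_copies[OF G H])
  define b where "b = (\<lambda>(i :: 'i) l C. Poly_Mapping.single i (Poly_Mapping.single (l :: nat)
    (Poly_Mapping.single (C :: 'g set) (1 :: 'k))))"
  \<comment> \<open>\<open>L f s\<close> is the coordinate of \<open>f\<close> at \<open>s\<close>:
    three nested layers of finitely supported functions are flattened into one index, and the
    vectors \<open>b\<close> are dual to these coordinates. Independence and spanning become
    comparisons of coordinates.\<close>
  define L where "L = (\<lambda>f ((i :: 'i, l :: nat), C :: 'g set). Poly_Mapping.lookup (Poly_Mapping.lookup
    (Poly_Mapping.lookup f i) l) C :: 'k)"
  have L_add: "L (f + g) s = L f s + L g s" for f g s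
    by (cases s) (auto simp: L_def lookup_add)
  have L_0: "L 0 s = 0" for s by (cases s) (auto simp: L_def)
  have L_sum: "L (sum f A) s = (\<Sum>x\<in>A. L (f x) s)" for f A s
    by (induction A rule: infinite_finite_induct) (auto simp: L_add L_0)
  have L_smul: "L (smul D c f) s = c * L f s" for c f s
    by (cases s) (auto simp: L_def D_def direct_sum_def copies_def coset_module_def perm_module_def
        lookup_mapp Poly_Mapping.map.rep_eq when_def in_keys_iff)
  have L_b: "L (b i l C) s = (if s = ((i, l), C) then 1 else 0)" for i l C s
    by (cases s) (auto simp: L_def b_def lookup_single when_def split: if_splits)
  have L_eqI: "f = g" if "\<And>s. L f s = L g s" for f g
    using that unfolding L_def by (intro poly_mapping_eqI) (metis (no_types, lifting) case_prod_conv)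
  define S where "S = (SIGMA j:(SIGMA i:I. {..<k i}). lcosets ((H \<circ> fst) j))"
  have S: "finite S" using I finite_lcosets[OF fin] by (auto simp: S_def)
  have D_carrier: "f \<in> carrier D \<longleftrightarrow> Poly_Mapping.keys f \<subseteq> I \<and>
      (\<forall>i\<in>I. Poly_Mapping.keys (Poly_Mapping.lookup f i) \<subseteq> {..<k i} \<and>
        (\<forall>l<k i. Poly_Mapping.keys (Poly_Mapping.lookup (Poly_Mapping.lookup f i) l) \<subseteq> lcosets (H i)))"
    for f
    by (simp add: D_def direct_sum_def copies_def coset_module_def perm_module_def Ball_def)
  have L_outside: "L f s = 0" if f: "f \<in> carrier D" and s: "s \<notin> S" for f s
  proof -
    obtain i l C where ilC: "s = ((i, l), C)" by (metis surj_pair)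
    consider "i \<notin> I" | "i \<in> I" "\<not> l < k i" | "i \<in> I" "l < k i" "C \<notin> lcosets (H i)"
      using s by (auto simp: ilC S_def)
    then show ?thesis
    proof cases
      case 1
      then have "Poly_Mapping.lookup f i = 0" using f by (auto simp: D_carrier in_keys_iff)
      then show ?thesis by (simp add: L_def ilC)
    next
      case 2
      then have "Poly_Mapping.lookup (Poly_Mapping.lookup f i) l = 0"
        using f unfolding D_carrier by (meson in_keys_iff lessThan_iff subsetD)
      then show ?thesis by (simp add: L_def ilC)
    next
      case 3
      then have "C \<notin> Poly_Mapping.keys (Poly_Mapping.lookup (Poly_Mapping.lookup f i) l)"
        using f unfolding D_carrier by blast
      then show ?thesis by (simp add: L_def ilC in_keys_iff)
    qed
  qed
  have b_closed: "b i l C \<in> carrier D" if "((i, l), C) \<in> S" for i l C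
    using that by (auto simp: D_carrier b_def S_def lookup_single when_def)
  have act_b: "act D g (b i l C) = b i l (g <#\<^bsub>G\<^esub> C)" for g i l C
    by (simp add: b_def D_def direct_sum_def copies_def coset_module_def perm_module_def mapp_single
        single_eq_0_iff)
  have b_fixed: "b i l (H i) \<in> fixed_points D (H i)" if "i \<in> I" "l < k i" for i l
    using that subgroup_in_lcosets[OF H] subgroup.mem_carrier[OF H] coset_join3[OF _ H]
    by (auto simp: fixed_points_def act_b S_def intro!: b_closed)
  have coset_act_b: "coset_act D C (b i l (H i)) = b i l C" if s: "((i, l), C) \<in> S" for i l C
  proof -
    obtain g where g: "g \<in> carrier G" "C = g <#\<^bsub>G\<^esub> H i" using s by (auto simp: S_def LCOSETS_def)
    have "i \<in> I" "l < k i" using s by (auto simp: S_def)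
    then show ?thesis
      using coset_act_l_coset[OF H b_fixed g(1)] g(2) by (simp add: act_b)
  qed
  define e where "e = (\<lambda>((i, l), C). b i l C)"
  have L_comb: "L (\<Sum>s\<in>S. smul D (a s) (e s)) t = (if t \<in> S then a t else 0)" for a t
  proof -
    have "L (\<Sum>s\<in>S. smul D (a s) (e s)) t = (\<Sum>s\<in>S. if s = t then a s else 0)"
      unfolding L_sum by (intro sum.cong) (auto simp: L_smul e_def L_b)
    then show ?thesis using S by (simp add: sum.delta)
  qed
  have "independent_family (smul D) S e"
    unfolding independent_family_def using L_comb L_0 by metis
  moreover have "span (e ` S) = carrier D"
  proof (rule subset_antisym)
    show "span (e ` S) \<subseteq> carrier D"
      using b_closed by (intro span_minimal subspace_carrier) (auto simp: e_def)
    show "carrier D \<subseteq> span (e ` S)"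
    proof
      fix f assume f: "f \<in> carrier D"
      have "f = (\<Sum>s\<in>S. smul D (L f s) (e s))"
        by (rule L_eqI) (use L_outside[OF f] in \<open>auto simp: L_comb\<close>)
      also have "\<dots> \<in> span (e ` S)" by (intro span_sum span_scale span_base) auto
      finally show "f \<in> span (e ` S)" .
    qed
  qed
  moreover define u where "u = (\<lambda>(i, l). b i l (H i))"
  define d where "d = (\<lambda>(j, C). coset_act D C (u j))"
  have de: "d s = e s" if "s \<in> S" for s
    using that coset_act_b by (cases s) (auto simp: d_def e_def u_def)
  ultimately have "independent_family (smul D) S d" "span (d ` S) = carrier D"
    unfolding independent_family_def by simp_all
  then have "orbit_basis G D (SIGMA i:I. {..<k i}) (H \<circ> fst) u"
    unfolding orbit_basis_def S_def d_def using I b_fixed by (auto simp: u_def)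
  then show ?thesis by (simp add: D_def u_def b_def)
qed

section \<open>Dimension inside finitely spanned sets, and Abel summation\<close>

context vector_space
begin

text \<open>The library's \<open>dim\<close> is the \<open>card\<close> of a basis, which is
  \<open>0\<close> for an infinite one; the finite set \<open>W\<close> excludes this case.\<close>

lemma card_independent_le_dim:
  assumes "finite W" "V \<subseteq> span W" "A \<subseteq> V" "independent A"
  shows "finite A \<and> card A \<le> dim V"
proof -
  obtain B where B: "B \<subseteq> V" "independent B" "V \<subseteq> span B" "card B = dim V"
    by (rule basis_exists)
  have "finite B" using independent_span_bound[OF assms(1) B(2)] B(1) assms(2) by blast
  then show ?thesis using independent_span_bound[of B A] assms(3,4) B(3,4) by auto
qed

lemma dim_le_if_subset:
  assumes "finite W" "V \<subseteq> span W" "U \<subseteq> V"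
  shows "dim U \<le> dim V"
proof -
  obtain B where B: "B \<subseteq> U" "independent B" "U \<subseteq> span B" "card B = dim U"
    by (rule basis_exists)
  then show ?thesis using card_independent_le_dim[OF assms(1,2), of B] assms(3) by auto
qed

lemma subspace_eq_if_dim_eq:
  assumes W: "finite W" "V \<subseteq> span W" and U: "subspace U" "U \<subseteq> V" "dim U = dim V"
  shows "U = V"
proof (rule ccontr)
  assume "U \<noteq> V"
  then obtain x where x: "x \<in> V" "x \<notin> U" using U(2) by blast
  obtain B where B: "B \<subseteq> U" "independent B" "U \<subseteq> span B" "card B = dim U"
    by (rule basis_exists)
  have "x \<notin> span B" using x(2) span_minimal[OF B(1) U(1)] by blast
  then have "independent (insert x B)" using B(2) by (simp add: independent_insert)
  then have "finite (insert x B) \<and> card (insert x B) \<le> dim V"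
    using x(1) B(1) U(2) by (intro card_independent_le_dim[OF W]) auto
  moreover have "x \<notin> B" using x(2) B(1) by blast
  ultimately have "Suc (card B) \<le> dim V" by (metis card_insert_disjoint finite_insert)
  then show False using B(4) U(3) by simp
qed

end

lemma sum_Sigma_fst:
  fixes f k :: "'i \<Rightarrow> nat"
  assumes "finite I"
  shows "(\<Sum>j\<in>(SIGMA i:I. {..<k i}). f (fst j)) = (\<Sum>i\<in>I. k i * f i)"
  using sum.Sigma[OF assms, of "\<lambda>i. {..<k i}" "\<lambda>i l. f i"] by (simp add: case_prod_beta)

text \<open>Abel summation: the differences of \<open>m\<close> and \<open>k\<close> have
  nonnegative partial sums, and the weights decrease. It runs over the integers because single
  differences may be negative.\<close>

lemma weighted_sum_mono:
  fixes w k m :: "nat \<Rightarrow> nat"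
  assumes w: "\<And>i. \<lbrakk>1 \<le> i; i < n\<rbrakk> \<Longrightarrow> w (Suc i) \<le> w i"
    and km: "\<And>r. r \<le> n \<Longrightarrow> (\<Sum>i = 1..r. k i) \<le> (\<Sum>i = 1..r. m i)"
  shows "(\<Sum>i = 1..n. k i * w i) \<le> (\<Sum>i = 1..n. m i * w i)"
proof -
  define d where "d i = int (m i) - int (k i)" for i
  have d: "0 \<le> (\<Sum>i = 1..r. d i)" if "r \<le> n" for r
  proof -
    have "int (\<Sum>i = 1..r. k i) \<le> int (\<Sum>i = 1..r. m i)" using km[OF that] by linarith
    then show ?thesis by (simp add: d_def sum_subtractf)
  qed
  \<comment> \<open>The induction invariant: passing from \<open>w (Suc r)\<close> to the next,
    smaller weight can only lower its product with the nonnegative partial sum.\<close>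
  have *: "int (w (Suc r)) * (\<Sum>i = 1..Suc r. d i) \<le> (\<Sum>i = 1..Suc r. d i * int (w i))"
    if "Suc r \<le> n" for r
    using that
  proof (induction r)
    case (Suc r)
    have "int (w (Suc (Suc r))) * (\<Sum>i = 1..Suc r. d i) \<le> int (w (Suc r)) * (\<Sum>i = 1..Suc r. d i)"
      using Suc.prems w[of "Suc r"] d[of "Suc r"] by (intro mult_right_mono) auto
    also have "\<dots> \<le> (\<Sum>i = 1..Suc r. d i * int (w i))" using Suc by simp
    finally show ?case by (simp add: algebra_simps)
  qed simp
  have "0 \<le> (\<Sum>i = 1..n. d i * int (w i))"
  proof (cases n)
    case (Suc r)
    then show ?thesis using *[of r] d[of n]
      by (metis mult_nonneg_nonneg of_nat_0_le_iff order_refl order_trans)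
  qed simp
  then have "int (\<Sum>i = 1..n. k i * w i) \<le> int (\<Sum>i = 1..n. m i * w i)"
    by (simp add: d_def left_diff_distrib sum_subtractf)
  then show ?thesis by linarith
qed

section \<open>Stabilizers, spans of translates and spaces of traces\<close>

context kG_module
begin

text \<open>Running through an orbit runs through all conjugates of a stabilizer. In a permuted
  basis this allows a representative whose stabilizer is a listed subgroup itself, not just a
  conjugate of one.\<close>

lemma conjugate_stabilizer:
  assumes g: "g \<in> carrier G" and b: "b \<in> carrier M" and x: "x \<in> carrier G"
  defines "K \<equiv> {k \<in> carrier G. act M k b = b}"
  shows "act M x (act M g b) = act M g b \<longleftrightarrow> x \<in> g <#\<^bsub>G\<^esub> (K #>\<^bsub>G\<^esub> inv\<^bsub>G\<^esub> g)"
proof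
  assume fixed: "act M x (act M g b) = act M g b"
  let ?k = "inv\<^bsub>G\<^esub> g \<otimes> x \<otimes> g"
  have "act M ?k b = b"
    using g b x fixed by (simp add: act_mult act_closed act_inv_act)
  then have "?k \<in> K" using g x by (simp add: K_def)
  moreover have "g \<otimes> (inv\<^bsub>G\<^esub> g \<otimes> x) = x" using g x by (simp flip: m_assoc)
  then have "x = g \<otimes> (?k \<otimes> inv\<^bsub>G\<^esub> g)" using g x by (simp add: m_assoc)
  ultimately show "x \<in> g <#\<^bsub>G\<^esub> (K #>\<^bsub>G\<^esub> inv\<^bsub>G\<^esub> g)" by (auto simp: l_coset_def r_coset_def)
next
  assume "x \<in> g <#\<^bsub>G\<^esub> (K #>\<^bsub>G\<^esub> inv\<^bsub>G\<^esub> g)"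
  then obtain k where k: "k \<in> carrier G" "act M k b = b" "x = g \<otimes> (k \<otimes> inv\<^bsub>G\<^esub> g)"
    by (auto simp: l_coset_def r_coset_def K_def)
  then show "act M x (act M g b) = act M g b"
    using g b by (simp add: act_mult act_closed act_inv_act)
qed

lemma subgroup_stabilizer:
  assumes b: "b \<in> carrier M"
  shows "subgroup {k \<in> carrier G. act M k b = b} G"
proof (rule subgroupI)
  show "{k \<in> carrier G. act M k b = b} \<noteq> {}" using b act_one one_closed by blast
qed (use b in \<open>auto simp: act_mult, metis act_inv_act\<close>)

lemma orbit_basis_dim:
  assumes "finite (carrier G)" "orbit_basis G M J K v"
  shows "dim (carrier M) = (\<Sum>j\<in>J. card (lcosets (K j)))"
proof -
  let ?S = "SIGMA j:J. lcosets (K j)" and ?e = "\<lambda>(j, C). coset_act M C (v j)"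
  have J: "finite J" and S: "finite ?S"
    using assms(2) finite_lcosets[OF assms(1)] by (auto simp: orbit_basis_def)
  have "dim (carrier M) = card (?e ` ?S)"
    using assms(2) independent_family_iff[OF S] unfolding orbit_basis_def
    by (metis (no_types, lifting) dim_span_eq_card_independent)
  also have "\<dots> = card ?S"
    using assms(2) independent_family_iff[OF S] unfolding orbit_basis_def
    by (intro card_image) blast
  also have "\<dots> = (\<Sum>j\<in>J. card (lcosets (K j)))"
    using J finite_lcosets[OF assms(1)] by (intro card_SigmaI) auto
  finally show ?thesis .
qed

lemma translates_invariant:
  assumes "\<And>j. j \<in> J \<Longrightarrow> subgroup (K j) G" "\<And>j. j \<in> J \<Longrightarrow> v j \<in> fixed_points M (K j)"
    and "g \<in> carrier G" "x \<in> (\<lambda>(j, C). coset_act M C (v j)) ` (SIGMA j:J. lcosets (K j))"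
  shows "act M g x \<in> (\<lambda>(j, C). coset_act M C (v j)) ` (SIGMA j:J. lcosets (K j))"
proof -
  obtain j C where x: "x = coset_act M C (v j)" "j \<in> J" "C \<in> lcosets (K j)"
    using assms(4) by auto
  then have "act M g x = (\<lambda>(j, C). coset_act M C (v j)) (j, g <#\<^bsub>G\<^esub> C)"
    using act_coset_act[OF assms(1,2) _ assms(3)] by simp
  moreover have "(j, g <#\<^bsub>G\<^esub> C) \<in> (SIGMA j:J. lcosets (K j))"
    using x l_coset_in_lcosets[OF subgroup.subset[OF assms(1)] assms(3)] by simp
  ultimately show ?thesis by (rule image_eqI)
qed

text \<open>Left multiplication permutes the cosets, so the translates form a
  \<open>G\<close>-stable set and their span is a submodule.\<close>

lemma submodule_span_translates:
  assumes J: "finite J" and K: "\<And>j. j \<in> J \<Longrightarrow> subgroup (K j) G"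
    and v: "\<And>j. j \<in> J \<Longrightarrow> v j \<in> fixed_points M (K j)"
    and ind: "independent_family (smul M) (SIGMA j:J. lcosets (K j)) (\<lambda>(j, C). coset_act M C (v j))"
    and N: "N = span ((\<lambda>(j, C). coset_act M C (v j)) ` (SIGMA j:J. lcosets (K j)))"
  shows "kG_submodule G N M" "orbit_basis G (M\<lparr>carrier := N\<rparr>) J K v"
proof -
  let ?E = "(\<lambda>(j, C). coset_act M C (v j)) ` (SIGMA j:J. lcosets (K j))"
  have E: "?E \<subseteq> carrier M" using coset_act_closed[OF K v] by auto
  have sub: "N \<subseteq> carrier M" unfolding N using E subspace_carrier by (rule span_minimal)
  show "kG_submodule G N M"
    unfolding kG_submodule_def
  proof (intro conjI ballI)
    fix g x assume g: "g \<in> carrier G" and "x \<in> N"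
    from this(2) have "x \<in> carrier M \<and> act M g x \<in> N" unfolding N
    proof (induction rule: span_induct_alt)
      case base
      show ?case using g by (simp add: zero_closed act_zero span_zero)
    next
      case (step c x y)
      have x: "x \<in> carrier M" using step.hyps E by blast
      have "act M g x \<in> span ?E"
        by (rule span_base, rule translates_invariant[OF K v g step.hyps])
      moreover have "smul M c x \<in> carrier M" using x by (rule subspace_scale[OF subspace_carrier])
      ultimately show ?case
        using g x step.IH subspace_add[OF subspace_carrier]
        by (simp add: act_add act_smul span_add span_scale)
    qed
    then show "act M g x \<in> N" ..
  qed (use sub N in auto)
  \<comment> \<open>Fixed vectors of the submodule must lie in \<open>N\<close>; a generator does,
    being its own translate by the trivial coset.\<close>
  have "v j \<in> N" if "j \<in> J" for j
  proof -
    have "v j = (\<lambda>(j, C). coset_act M C (v j)) (j, K j)"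
      using coset_act_self[OF K v] that by simp
    moreover have "(j, K j) \<in> (SIGMA j:J. lcosets (K j))"
      using subgroup_in_lcosets[OF K] that by simp
    ultimately have "v j \<in> ?E" by (rule image_eqI)
    then show ?thesis unfolding N by (rule span_base)
  qed
  then show "orbit_basis G (M\<lparr>carrier := N\<rparr>) J K v"
    using J v ind by (auto simp: orbit_basis_def fixed_points_def coset_act_def N)
qed

definition trace_image :: "'g set \<Rightarrow> 'g set \<Rightarrow> 'm set" where
  "trace_image K S = (\<lambda>v. \<Sum>t\<in>S. act M t v) ` fixed_points M K"

lemma subspace_fixed_points: "K \<subseteq> carrier G \<Longrightarrow> subspace (fixed_points M K)"
  by (rule subspaceI)
    (auto simp: fixed_points_def zero_closed act_zero act_add act_smul subset_iff
      intro: subspace_add[OF subspace_carrier] subspace_scale[OF subspace_carrier])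

lemma subspace_trace_image:
  assumes K: "K \<subseteq> carrier G" and S: "S \<subseteq> carrier G"
  shows "subspace (trace_image K S)"
proof (rule subspaceI)
  let ?tr = "\<lambda>v. \<Sum>t\<in>S. act M t v"
  have "?tr 0 = 0" using S by (intro sum.neutral) (auto simp: act_zero)
  then show "0 \<in> trace_image K S"
    unfolding trace_image_def using subspace_0[OF subspace_fixed_points[OF K]] by (metis image_eqI)
  fix x assume "x \<in> trace_image K S"
  then obtain v where v: "v \<in> fixed_points M K" "x = ?tr v" by (auto simp: trace_image_def)
  have "smul M c x = ?tr (smul M c v)" for c
    unfolding v(2) scale_sum_right
    using S v(1) by (intro sum.cong) (auto simp: act_smul fixed_points_carrier)
  then show "smul M c x \<in> trace_image K S" for c
    unfolding trace_image_def using v(1) subspace_scale[OF subspace_fixed_points[OF K]] by blast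
  fix y assume "y \<in> trace_image K S"
  then obtain u where u: "u \<in> fixed_points M K" "y = ?tr u" by (auto simp: trace_image_def)
  have "x + y = ?tr (v + u)"
    unfolding v(2) u(2) sum.distrib[symmetric]
    using S v(1) u(1) by (intro sum.cong) (auto simp: act_add fixed_points_carrier)
  then show "x + y \<in> trace_image K S"
    unfolding trace_image_def using v(1) u(1) subspace_add[OF subspace_fixed_points[OF K]] by blast
qed

lemma trace_image_closed: "S \<subseteq> carrier G \<Longrightarrow> trace_image K S \<subseteq> carrier M"
  by (auto simp: trace_image_def fixed_points_def act_closed subset_iff
      intro!: subspace_sum[OF subspace_carrier])

lemma trace_filtration_Suc_eq:
  "trace_filtration M H T (Suc r) =
     {x + y | x y. x \<in> trace_filtration M H T r \<and> y \<in> trace_image (H (Suc r)) (T (Suc r))}"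
  by (simp add: trace_image_def)

end

subsection \<open>The trace filtration\<close>

locale trace_filtration_setup = kG_module G M
  for G :: "('g, 'b) monoid_scheme" (structure)
    and M :: "('p::prime_card mod_ring, 'g, 'm::ab_group_add) kG_mod" +
  fixes H T :: "nat \<Rightarrow> 'g set" and n :: nat
  assumes finite_G: "finite (carrier G)"
    and p_group: "\<exists>a. card (carrier G) = CARD('p) ^ a"
    and fin_gen: "kG_fin_gen G M"
    and subgroup_H: "\<And>i. i \<in> {1..n} \<Longrightarrow> subgroup (H i) G"
    and transversal_T: "\<And>i. i \<in> {1..n} \<Longrightarrow> left_transversal G (H i) (T i)"
    and card_H_mono: "\<And>i. \<lbrakk>1 \<le> i; i < n\<rbrakk> \<Longrightarrow> card (H i) \<le> card (H (Suc i))"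
begin

abbreviation trace :: "nat \<Rightarrow> 'm \<Rightarrow> 'm" where
  "trace i v \<equiv> \<Sum>t\<in>T i. act M t v"

abbreviation filt :: "nat \<Rightarrow> 'm set" where
  "filt \<equiv> trace_filtration M H T"

abbreviation mult :: "nat \<Rightarrow> nat" where
  "mult \<equiv> layer_dim M H T"

lemma T_subset: "i \<in> {1..n} \<Longrightarrow> T i \<subseteq> carrier G"
  using transversal_T by (simp add: left_transversal_def)

lemma H_subset: "i \<in> {1..n} \<Longrightarrow> H i \<subseteq> carrier G"
  using subgroup_H by (rule subgroup.subset)

lemma filt_subspace: "r \<le> n \<Longrightarrow> subspace (filt r) \<and> filt r \<subseteq> carrier M"
proof (induction r)
  case 0
  show ?case by (simp add: zero_closed)
next
  case (Suc r)
  then have r: "subspace (filt r)" "filt r \<subseteq> carrier M" "Suc r \<in> {1..n}" by auto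
  have "subspace (filt (Suc r))"
    unfolding trace_filtration_Suc_eq
    using r T_subset H_subset by (intro subspace_sums subspace_trace_image) auto
  moreover have "filt (Suc r) \<subseteq> carrier M"
    unfolding trace_filtration_Suc_eq
    using r trace_image_closed[OF T_subset[OF r(3)]] subspace_add[OF subspace_carrier] by blast
  ultimately show ?case ..
qed

lemma filt_mono: "\<lbrakk>r \<le> s; s \<le> n\<rbrakk> \<Longrightarrow> filt r \<subseteq> filt s"
proof (induction s rule: dec_induct)
  case (step s)
  then have "filt s \<subseteq> filt (Suc s)"
    using T_subset[of "Suc s"] H_subset[of "Suc s"]
    by (intro trace_filtration_mono[OF kG_module_axioms]) auto
  then show ?case using step by auto
qed simp

lemma trace_image_subset_filt: "Suc r \<le> n \<Longrightarrow> trace_image (H (Suc r)) (T (Suc r)) \<subseteq> filt (Suc r)"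
  unfolding trace_filtration_Suc_eq using filt_subspace[of r] subspace_0 by force

lemma trace_in_filt:
  assumes "i \<in> {1..n}" "v \<in> fixed_points M (H i)"
  shows "trace i v \<in> filt i"
proof -
  obtain r where "i = Suc r" using assms(1) by (cases i) auto
  then show ?thesis
    using assms trace_image_subset_filt[of r] unfolding trace_image_def by fastforce
qed

lemma filt_Suc_span: "Suc r \<le> n \<Longrightarrow> filt (Suc r) \<subseteq> span (filt r \<union> trace_image (H (Suc r)) (T (Suc r)))"
  unfolding trace_filtration_Suc_eq by (auto intro!: span_add intro: span_base)

lemma carrier_finite_span: obtains W where "finite W" "carrier M \<subseteq> span W"
  using finite_spanning_set[OF finite_G fin_gen] by (metis order_refl)

lemma filt_finite_span: assumes "r \<le> n" obtains W where "finite W" "filt r \<subseteq> span W"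
  using carrier_finite_span filt_subspace[OF assms] by (metis order_trans)

text \<open>The truncated differences in \<open>layer_dim\<close> are genuine, since the filtration
  increases inside a finite-dimensional space; hence the sum telescopes down to
  \<open>dim {0} = 0\<close>.\<close>

lemma sum_mult: "r \<le> n \<Longrightarrow> (\<Sum>i = 1..r. mult i) = dim (filt r)"
proof (induction r)
  case 0
  have "dim {0 :: 'm} = 0"
    using dim_le_card[of "{0}" "{}"] by (simp add: span_empty)
  then show ?case by simp
next
  case (Suc r)
  obtain W where "finite W" "filt (Suc r) \<subseteq> span W" using Suc.prems by (rule filt_finite_span)
  then have "dim (filt r) \<le> dim (filt (Suc r))"
    using dim_le_if_subset filt_mono[of r "Suc r"] Suc.prems by simp
  then show ?case using Suc by (simp add: layer_dim_def)
qed

lemma dim_filt_Suc: "Suc r \<le> n \<Longrightarrow> dim (filt (Suc r)) = dim (filt r) + mult (Suc r)"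
  using sum_mult[of r] sum_mult[of "Suc r"] by simp

lemma card_lcosets_H: "i \<in> {1..n} \<Longrightarrow> card (lcosets (H i)) * card (H i) = Coset.order G"
  using l_lagrange[OF finite_G subgroup_H] .

lemma card_lcosets_antimono:
  assumes "1 \<le> i" "i < n"
  shows "card (lcosets (H (Suc i))) \<le> card (lcosets (H i))"
proof (rule ccontr)
  assume less: "\<not> ?thesis"
  have pos: "0 < card (H i)"
    using finite_G H_subset[of i] subgroup.one_closed[OF subgroup_H[of i]] assms
    by (auto simp: card_gt_0_iff dest: finite_subset)
  have "card (lcosets (H i)) * card (H i) < card (lcosets (H (Suc i))) * card (H (Suc i))"
    using less card_H_mono[OF assms] pos by (intro mult_less_le_imp_less) auto
  then show False using card_lcosets_H[of i] card_lcosets_H[of "Suc i"] assms by simp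
qed

lemma sum_coset_act_eq_trace:
  "\<lbrakk>i \<in> {1..n}; v \<in> fixed_points M (H i)\<rbrakk> \<Longrightarrow> (\<Sum>C\<in>lcosets (H i). coset_act M C v) = trace i v"
  using sum_coset_act_transversal subgroup_H transversal_T by blast

text \<open>\<open>\<tau>\<close> names the subgroup of a generator and is kept apart from the index
  set \<open>J\<close>: generators are numbered below by pairs \<open>(i, l)\<close> with
  \<open>\<tau> = fst\<close>, but also by the orbits of a permuted basis.\<close>

lemma independent_translates_iff:
  assumes "finite J" "\<tau> ` J \<subseteq> {1..n}" "\<And>j. j \<in> J \<Longrightarrow> v j \<in> fixed_points M (H (\<tau> j))"
  shows "independent_family (smul M) (SIGMA j:J. lcosets ((H \<circ> \<tau>) j)) (\<lambda>(j, C). coset_act M C (v j)) \<longleftrightarrow>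
         independent_family (smul M) J (\<lambda>j. trace (\<tau> j) (v j))"
proof -
  have "independent_family (smul M) J (\<lambda>j. \<Sum>C\<in>lcosets ((H \<circ> \<tau>) j). coset_act M C (v j)) \<longleftrightarrow>
        independent_family (smul M) J (\<lambda>j. trace (\<tau> j) (v j))"
    using assms unfolding independent_family_def
    by (simp add: sum_coset_act_eq_trace image_subset_iff cong: sum.cong)
  moreover obtain a where "card (carrier G) = CARD('p) ^ a" using p_group by blast
  ultimately show ?thesis
    using independent_translates_iff_independent_traces[OF kG_module_axioms finite_G _ assms(1),
        of a "H \<circ> \<tau>" v] assms subgroup_H by (auto simp: image_subset_iff)
qed

text \<open>The traces of the generators indexed by \<open>\<tau> j \<le> r\<close> are independent in \<open>M\<^sub>r\<close>; Abel summation
  against the decreasing indices \<open>|G : G\<^sub>i|\<close> turns these \<open>n\<close> inequalities into the bound.\<close>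

lemma translates_card_bound:
  assumes J: "finite J" "\<tau> ` J \<subseteq> {1..n}"
    and v: "\<And>j. j \<in> J \<Longrightarrow> v j \<in> fixed_points M (H (\<tau> j))"
    and ind: "independent_family (smul M) (SIGMA j:J. lcosets ((H \<circ> \<tau>) j))
      (\<lambda>(j, C). coset_act M C (v j))"
  shows "(\<Sum>j\<in>J. card (lcosets (H (\<tau> j)))) \<le> (\<Sum>i = 1..n. mult i * card (lcosets (H i)))"
proof -
  let ?w = "\<lambda>i. card (lcosets (H i))"
  define e where "e = (\<lambda>j. trace (\<tau> j) (v j))"
  define k where "k = (\<lambda>i. card {j\<in>J. \<tau> j = i})"
  have e: "inj_on e J" "independent (e ` J)"
    using ind independent_translates_iff[OF J v] independent_family_iff[OF J(1)]
    unfolding e_def by blast+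
  have k_sum: "(\<Sum>i = 1..r. k i) = card {j\<in>J. \<tau> j \<le> r}" for r
  proof -
    have "{j\<in>J. \<tau> j \<le> r} = (\<Union>i\<in>{1..r}. {j\<in>J. \<tau> j = i})" using J(2) by fastforce
    moreover have "card (\<Union>i\<in>{1..r}. {j\<in>J. \<tau> j = i}) = (\<Sum>i\<in>{1..r}. card {j\<in>J. \<tau> j = i})"
      using J(1) by (intro card_UN_disjoint) auto
    ultimately show ?thesis by (simp add: k_def)
  qed
  have k_mult: "(\<Sum>i = 1..r. k i) \<le> (\<Sum>i = 1..r. mult i)" if r: "r \<le> n" for r
  proof -
    let ?J = "{j\<in>J. \<tau> j \<le> r}"
    obtain W where W: "finite W" "filt r \<subseteq> span W" using r by (rule filt_finite_span)
    have "e ` ?J \<subseteq> filt r"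
    proof
      fix x assume "x \<in> e ` ?J"
      then obtain j where j: "x = e j" "j \<in> J" "\<tau> j \<le> r" by blast
      then have "x \<in> filt (\<tau> j)"
        using J(2) v[OF j(2)] by (auto simp: e_def intro!: trace_in_filt)
      then show "x \<in> filt r" using filt_mono[OF j(3) r] by blast
    qed
    moreover have "independent (e ` ?J)"
      using e(2) by (rule independent_mono) auto
    ultimately have "card (e ` ?J) \<le> dim (filt r)"
      using card_independent_le_dim[OF W] by blast
    moreover have "card (e ` ?J) = card ?J"
      using e(1) by (intro card_image) (auto simp: inj_on_def)
    ultimately show ?thesis using k_sum sum_mult[OF r] by simp
  qed
  have "(\<Sum>j\<in>J. ?w (\<tau> j)) = (\<Sum>i\<in>{1..n}. \<Sum>j\<in>{j\<in>J. \<tau> j = i}. ?w (\<tau> j))"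
    using J by (intro sum.group[symmetric]) auto
  also have "\<dots> = (\<Sum>i = 1..n. k i * ?w i)" by (simp add: k_def)
  also have "\<dots> \<le> (\<Sum>i = 1..n. mult i * ?w i)"
    using card_lcosets_antimono k_mult by (rule weighted_sum_mono)
  finally show ?thesis .
qed

text \<open>Built layer by layer, with the lifts carried along. The pair \<open>(i, l)\<close>
  stands for the \<open>l\<close>-th new vector of layer \<open>i\<close>, so the index set already
  records the multiplicities.\<close>

lemma trace_basis:
  assumes "r \<le> n"
  shows "\<exists>v. (\<forall>j\<in>(SIGMA i:{1..r}. {..<mult i}). v j \<in> fixed_points M (H (fst j))) \<and>
    inj_on (\<lambda>j. trace (fst j) (v j)) (SIGMA i:{1..r}. {..<mult i}) \<and>
    independent ((\<lambda>j. trace (fst j) (v j)) ` (SIGMA i:{1..r}. {..<mult i})) \<and>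
    span ((\<lambda>j. trace (fst j) (v j)) ` (SIGMA i:{1..r}. {..<mult i})) = filt r"
  using assms
proof (induction r)
  case 0
  show ?case by (simp add: span_empty independent_empty)
next
  case (Suc r)
  let ?J = "\<lambda>r. SIGMA i:{1..r}. {..<mult i}"
  let ?I = "trace_image (H (Suc r)) (T (Suc r))"
  from Suc.IH[OF Suc_leD[OF Suc.prems]]
  obtain v where v: "\<forall>j\<in>?J r. v j \<in> fixed_points M (H (fst j))"
    "inj_on (\<lambda>j. trace (fst j) (v j)) (?J r)"
    "independent ((\<lambda>j. trace (fst j) (v j)) ` ?J r)"
    "span ((\<lambda>j. trace (fst j) (v j)) ` ?J r) = filt r"
    by blast
  define B where "B = (\<lambda>j. trace (fst j) (v j)) ` ?J r"
  have B: "independent B" "span B = filt r" "finite B" using v by (auto simp: B_def)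
  \<comment> \<open>Extending inside \<open>B \<union> ?I\<close> makes each new vector a trace from
    \<open>H (Suc r)\<close>; an arbitrary vector of the next layer may be only the sum of such a
    trace and an older vector.\<close>
  obtain C where C: "B \<subseteq> C" "C \<subseteq> B \<union> ?I" "independent C" "B \<union> ?I \<subseteq> span C"
    using maximal_independent_subset_extend[of B "B \<union> ?I"] B(1) by auto
  have sub: "subspace (filt (Suc r))" using filt_subspace Suc.prems by blast
  have C_filt: "C \<subseteq> filt (Suc r)"
    using C(2) B(2) span_superset[of B] filt_mono[OF le_SucI[OF order_refl] Suc.prems]
      trace_image_subset_filt[OF Suc.prems]
    by blast
  have span_C: "span C = filt (Suc r)"
  proof (rule subset_antisym)
    show "span C \<subseteq> filt (Suc r)" using C_filt sub by (rule span_minimal)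
    have "filt r \<subseteq> span C" using span_mono[OF C(1)] B(2) by simp
    then have "span (filt r \<union> ?I) \<subseteq> span C" using C(4) by (intro span_minimal) auto
    then show "filt (Suc r) \<subseteq> span C" using filt_Suc_span[OF Suc.prems] by blast
  qed
  obtain W where "finite W" "filt (Suc r) \<subseteq> span W" using Suc.prems by (rule filt_finite_span)
  then have finC: "finite C" using card_independent_le_dim[OF _ _ C_filt C(3)] by blast
  have "card C = dim (filt (Suc r))" "card B = dim (filt r)"
    using dim_span_eq_card_independent[OF C(3)] dim_span_eq_card_independent[OF B(1)] span_C B(2)
    by simp_all
  \<comment> \<open>The new vectors account for the growth of the dimension, so they can be numbered
    by \<open>l < mult (Suc r)\<close>.\<close>
  then have "card (C - B) = mult (Suc r)"
    using dim_filt_Suc[OF Suc.prems] C(1) B(3) by (simp add: card_Diff_subset)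
  then obtain h where h: "bij_betw h {..<mult (Suc r)} (C - B)"
    using ex_bij_betw_nat_finite[of "C - B"] finC by (auto simp: lessThan_atLeast0)
  have "\<exists>u. u \<in> fixed_points M (H (Suc r)) \<and> trace (Suc r) u = h l" if "l < mult (Suc r)" for l
  proof -
    have "h l \<in> ?I" using that bij_betwE[OF h] C(2) by blast
    then show ?thesis by (auto simp: trace_image_def)
  qed
  then obtain u where u: "\<And>l. l < mult (Suc r) \<Longrightarrow> u l \<in> fixed_points M (H (Suc r))"
    "\<And>l. l < mult (Suc r) \<Longrightarrow> trace (Suc r) (u l) = h l"
    by metis
  define x where "x = (\<lambda>j. if fst j = Suc r then u (snd j) else v j)"
  define e where "e = (\<lambda>j. trace (fst j) (x j))"
  let ?new = "Pair (Suc r) ` {..<mult (Suc r)}"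
  have J: "?J (Suc r) = ?J r \<union> ?new" by (auto simp: le_Suc_eq)
  have old: "e j = trace (fst j) (v j)" if "j \<in> ?J r" for j
    using that by (auto simp: e_def x_def)
  have new: "e (Suc r, l) = h l" if "l < mult (Suc r)" for l
    using that u by (simp add: e_def x_def)
  have im_old: "e ` ?J r = B" unfolding B_def by (rule image_cong[OF refl old])
  have "e ` ?new = h ` {..<mult (Suc r)}"
    unfolding image_image using new by (intro image_cong) auto
  then have im_new: "e ` ?new = C - B" using h by (simp add: bij_betw_def)
  have im: "e ` ?J (Suc r) = C" unfolding J image_Un im_old im_new using C(1) by blast
  have "inj_on e (?J r)" using v(2) inj_on_cong[of "?J r" e, OF old] by blast
  moreover have "inj_on e ?new"
    using bij_betw_imp_inj_on[OF h] new by (auto simp: inj_on_def)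
  moreover have "e ` (?J r - ?new) \<inter> e ` (?new - ?J r) = {}"
    using im_old im_new by blast
  ultimately have "inj_on e (?J (Suc r))" unfolding J inj_on_Un by blast
  moreover have "\<forall>j\<in>?J (Suc r). x j \<in> fixed_points M (H (fst j))"
    unfolding J using u(1) v(1) by (auto simp: x_def)
  ultimately show ?case
    using C(3) span_C im unfolding e_def by (intro exI[of _ x]) blast
qed

text \<open>The standard generators of the direct sum are carried back to \<open>N\<close>. A
  submodule inherits scalars and action, so they are fixed vectors of \<open>M\<close> with the same
  independent translates, and \<open>translates_card_bound\<close> applies inside
  \<open>M\<close>.\<close>

lemma dim_submodule_bound:
  assumes N: "kG_submodule G N M"
    and iso: "kG_iso G (M\<lparr>carrier := N\<rparr>)
      (direct_sum {1..n} (\<lambda>i. copies (k i) (coset_module G (H i))))"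
  shows "dim N \<le> (\<Sum>i = 1..n. mult i * card (lcosets (H i)))"
proof -
  let ?D = "direct_sum {1..n} (\<lambda>i. copies (k i) (coset_module G (H i))) ::
    ('p mod_ring, 'g, nat \<Rightarrow>\<^sub>0 nat \<Rightarrow>\<^sub>0 'g set \<Rightarrow>\<^sub>0 'p mod_ring) kG_mod"
  let ?J = "SIGMA i:{1..n}. {..<k i}"
  interpret N: kG_module G "M\<lparr>carrier := N\<rparr>" using N by (rule kG_module_submodule)
  have D: "kG_module G ?D"
    using is_group subgroup_H by (rule kG_module_direct_sum_copies)
  have H: "subgroup ((H \<circ> fst) j) G" if "j \<in> ?J" for j
    using that subgroup_H by auto
  obtain w where w: "orbit_basis G (M\<lparr>carrier := N\<rparr>) ?J (H \<circ> fst) w"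
    using orbit_basis_if_kG_iso[OF D N.kG_module_axioms H
        orbit_basis_direct_sum_copies[OF is_group finite_G _ subgroup_H]
        kG_iso_sym[OF N.kG_module_axioms iso]] by auto
  have "dim N = (\<Sum>j\<in>?J. card (lcosets (H (fst j))))"
    using N.orbit_basis_dim[OF finite_G w] by simp
  also have "\<dots> \<le> (\<Sum>i = 1..n. mult i * card (lcosets (H i)))"
  proof (rule translates_card_bound)
    have "N \<subseteq> carrier M" using N by (simp add: kG_submodule_def)
    then show "w j \<in> fixed_points M (H (fst j))" if "j \<in> ?J" for j
      using w that by (fastforce simp: orbit_basis_def fixed_points_def)
    show "independent_family (smul M) (SIGMA j:?J. lcosets ((H \<circ> fst) j)) (\<lambda>(j, C). coset_act M C (w j))"
      using w by (simp add: orbit_basis_def coset_act_def)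
  qed auto
  finally show ?thesis .
qed

text \<open>Each orbit of the permuted basis has a representative whose stabilizer is exactly some
  \<open>H i\<close>. The basis then consists of the translates of these representatives without
  repetition, and the counting bound applies to all of \<open>M\<close>.\<close>

lemma dim_permutation_module_bound:
  assumes perm: "is_permutation_module G M"
    and conj: "\<And>K. subgroup K G \<Longrightarrow>
      \<exists>i\<in>{1..n}. \<exists>g\<in>carrier G. H i = g <#\<^bsub>G\<^esub> (K #>\<^bsub>G\<^esub> inv\<^bsub>G\<^esub> g)"
  shows "dim (carrier M) \<le> (\<Sum>i = 1..n. mult i * card (lcosets (H i)))"
proof -
  obtain B where B: "B \<subseteq> carrier M" "independent B" "span B = carrier M"
    and bij: "\<And>g. g \<in> carrier G \<Longrightarrow> bij_betw (act M g) B B"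
    using perm by (auto simp: is_permutation_module_def)
  obtain W where "finite W" "carrier M \<subseteq> span W" by (rule carrier_finite_span)
  then have finB: "finite B" using card_independent_le_dim[OF _ _ B(1,2)] by blast
  have act_B: "act M g b \<in> B" if "g \<in> carrier G" "b \<in> B" for g b
    using bij_betwE[OF bij[OF that(1)]] that(2) by blast
  define orb where "orb = (\<lambda>b. (\<lambda>g. act M g b) ` carrier G)"
  have orb_self: "b \<in> orb b" if "b \<in> B" for b
    using that B(1) act_one[of b] one_closed by (force simp: orb_def)
  have orb_act: "orb (act M g b) = orb b" if g: "g \<in> carrier G" and bB: "b \<in> B" for g b
  proof -
    have b: "b \<in> carrier M" using bB B(1) by blast
    show ?thesis
    proof (rule subset_antisym; rule subsetI)
      fix x assume "x \<in> orb (act M g b)"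
      then obtain h where "h \<in> carrier G" "x = act M (h \<otimes> g) b"
        using g b by (auto simp: orb_def act_mult)
      then show "x \<in> orb b" using g by (auto simp: orb_def)
    next
      fix x assume "x \<in> orb b"
      then obtain h where "h \<in> carrier G" "x = act M (h \<otimes> inv\<^bsub>G\<^esub> g) (act M g b)"
        using g b by (auto simp: orb_def act_mult act_closed act_inv_act)
      then show "x \<in> orb (act M g b)" using g by (auto simp: orb_def)
    qed
  qed
  define J where "J = orb ` B"
  have "\<exists>b i. b \<in> B \<and> orb b = X \<and> i \<in> {1..n} \<and> (\<forall>x\<in>carrier G. act M x b = b \<longleftrightarrow> x \<in> H i)"
    if "X \<in> J" for X
  proof -
    obtain b where b: "b \<in> B" "X = orb b" using \<open>X \<in> J\<close> by (auto simp: J_def)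
    then have bM: "b \<in> carrier M" using B(1) by blast
    \<comment> \<open>The conjugating element \<open>g\<close> moves \<open>b\<close> to the desired
      representative \<open>act M g b\<close>, which stays in the orbit \<open>X\<close>.\<close>
    obtain i g where i: "i \<in> {1..n}" and g: "g \<in> carrier G"
      and Hi: "H i = g <#\<^bsub>G\<^esub> ({k \<in> carrier G. act M k b = b} #>\<^bsub>G\<^esub> inv\<^bsub>G\<^esub> g)"
      using conj[OF subgroup_stabilizer[OF bM]] by blast
    have "\<forall>x\<in>carrier G. act M x (act M g b) = act M g b \<longleftrightarrow> x \<in> H i"
      unfolding Hi using conjugate_stabilizer[OF g bM] by blast
    then show ?thesis using i g b act_B orb_act by blast
  qed
  then obtain v \<tau> where v: "\<And>X. X \<in> J \<Longrightarrow> v X \<in> B" "\<And>X. X \<in> J \<Longrightarrow> orb (v X) = X"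
    and \<tau>: "\<And>X. X \<in> J \<Longrightarrow> \<tau> X \<in> {1..n}"
    and stab: "\<And>X x. \<lbrakk>X \<in> J; x \<in> carrier G\<rbrakk> \<Longrightarrow> act M x (v X) = v X \<longleftrightarrow> x \<in> H (\<tau> X)"
    by metis
  have vM: "v X \<in> carrier M" if "X \<in> J" for X using v(1)[OF that] B(1) by blast
  have v_fixed: "v X \<in> fixed_points M (H (\<tau> X))" if "X \<in> J" for X
    using that vM stab[OF that] H_subset[OF \<tau>[OF that]] by (auto simp: fixed_points_def)
  let ?S = "SIGMA X:J. lcosets ((H \<circ> \<tau>) X)"
  let ?e = "\<lambda>(X, C). coset_act M C (v X)"
  have e: "?e (X, g <#\<^bsub>G\<^esub> H (\<tau> X)) = act M g (v X)" if "X \<in> J" "g \<in> carrier G" for X g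
    using coset_act_l_coset[OF subgroup_H[OF \<tau>] v_fixed] that by simp
  have S_cases: "\<exists>X g. s = (X, g <#\<^bsub>G\<^esub> H (\<tau> X)) \<and> X \<in> J \<and> g \<in> carrier G" if "s \<in> ?S" for s
    using that by (auto simp: LCOSETS_def)
  \<comment> \<open>Here the stabilizer has to equal \<open>H (\<tau> X)\<close>: if it were larger,
    distinct cosets would give the same translate.\<close>
  have inj: "inj_on ?e ?S"
  proof (rule inj_onI)
    fix s t assume "s \<in> ?S" "t \<in> ?S" and eq: "?e s = ?e t"
    then obtain X g Y h where s: "s = (X, g <#\<^bsub>G\<^esub> H (\<tau> X))" "X \<in> J" "g \<in> carrier G"
      and t: "t = (Y, h <#\<^bsub>G\<^esub> H (\<tau> Y))" "Y \<in> J" "h \<in> carrier G"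
      using S_cases by metis
    have eq': "act M g (v X) = act M h (v Y)" using eq e s t by simp
    then have X: "X = Y" using orb_act v s t by metis
    have "act M (inv\<^bsub>G\<^esub> g \<otimes> h) (v X) = v X"
      using eq' s t vM X by (simp add: act_mult act_inv_act eq'[symmetric])
    then have "inv\<^bsub>G\<^esub> g \<otimes> h \<in> H (\<tau> X)" using stab s t by simp
    then have "h \<in> g <#\<^bsub>G\<^esub> H (\<tau> X)"
      using subgroup.lcos_module_rev[OF subgroup_H[OF \<tau>] is_group] s t by blast
    then show "s = t"
      using l_repr_independence[OF _ s(3) subgroup_H[OF \<tau>]] s t X by simp
  qed
  have img: "?e ` ?S = B"
  proof (rule subset_antisym; rule subsetI)
    fix x assume "x \<in> ?e ` ?S"
    then obtain s where "s \<in> ?S" "x = ?e s" by blast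
    then show "x \<in> B" using S_cases[of s] e v(1) act_B by metis
  next
    fix b assume b: "b \<in> B"
    then have X: "orb b \<in> J" by (simp add: J_def)
    then have "b \<in> orb (v (orb b))" using v(2) orb_self[OF b] by simp
    then obtain g where g: "g \<in> carrier G" "b = act M g (v (orb b))" by (auto simp: orb_def)
    then have "b = ?e (orb b, g <#\<^bsub>G\<^esub> H (\<tau> (orb b)))" using e[OF X] by simp
    moreover have "(orb b, g <#\<^bsub>G\<^esub> H (\<tau> (orb b))) \<in> ?S" using X g by (auto simp: LCOSETS_def)
    ultimately show "b \<in> ?e ` ?S" by (rule image_eqI)
  qed
  have J: "finite J" using finB by (simp add: J_def)
  have S: "finite ?S" using J finite_lcosets[OF finite_G] by auto
  have ind: "independent_family (smul M) ?S ?e"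
    using independent_family_iff[OF S] inj img B(2) by metis
  have basis: "orbit_basis G M J (H \<circ> \<tau>) v"
    using J v_fixed ind img B(3) by (simp add: orbit_basis_def)
  have "dim (carrier M) = (\<Sum>X\<in>J. card (lcosets (H (\<tau> X))))"
    using orbit_basis_dim[OF finite_G basis] by simp
  also have "\<dots> \<le> (\<Sum>i = 1..n. mult i * card (lcosets (H i)))"
    using J \<tau> v_fixed ind by (intro translates_card_bound) auto
  finally show ?thesis .
qed

text \<open>The independent traces of \<open>trace_basis\<close> make the translates independent,
  hence a basis of their span. That no admissible submodule is larger is the content of
  \<open>dim_submodule_bound\<close>.\<close>

lemma maximal_submodule:
  assumes m: "\<And>i. i \<in> {1..n} \<Longrightarrow> m i = mult i"
  obtains v N where "kG_submodule G N M"
    "orbit_basis G (M\<lparr>carrier := N\<rparr>) (SIGMA i:{1..n}. {..<m i}) (H \<circ> fst) v"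
proof -
  let ?J = "SIGMA i:{1..n}. {..<m i}"
  have J: "(SIGMA i:{1..n}. {..<mult i}) = ?J" using m by (intro Sigma_cong) auto
  obtain v where v: "\<forall>j\<in>?J. v j \<in> fixed_points M (H (fst j))"
    "inj_on (\<lambda>j. trace (fst j) (v j)) ?J" "independent ((\<lambda>j. trace (fst j) (v j)) ` ?J)"
    using trace_basis[of n] unfolding J by blast
  have fin: "finite ?J" by simp
  have "independent_family (smul M) ?J (\<lambda>j. trace (fst j) (v j))"
    using v(2,3) independent_family_iff[OF fin] by blast
  then have ind: "independent_family (smul M) (SIGMA j:?J. lcosets ((H \<circ> fst) j))
      (\<lambda>(j, C). coset_act M C (v j))"
    using independent_translates_iff[OF fin, of fst v] v(1) by force
  show ?thesis
    by (rule that[OF submodule_span_translates[OF fin _ _ ind refl]])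
      (use subgroup_H v(1) in auto)
qed

end

theorem proposition7p1:
  fixes G :: "('g, 'b) monoid_scheme"
    and M :: "('p::prime_card mod_ring, 'g, 'm::ab_group_add) kG_mod"
    and H T :: "nat \<Rightarrow> 'g set"
    and n :: nat
    and m :: "nat \<Rightarrow> nat"
  assumes "group G" and "finite (carrier G)" and "\<exists>a. card (carrier G) = CARD('p) ^ a"
    and "\<forall>i\<in>{1..n}. subgroup (H i) G"
    and "\<forall>i. 1 \<le> i \<and> i < n \<longrightarrow> card (H (i + 1)) \<ge> card (H i)"
    and "kG_module G M" and "kG_fin_gen G M"
    and "\<forall>i\<in>{1..n}. left_transversal G (H i) (T i)"
    and "\<forall>i\<in>{1..n}. m i = layer_dim M H T i"
  shows "\<exists>M'. kG_submodule G M' M \<and>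
      kG_iso G (M\<lparr>carrier := M'\<rparr>) (direct_sum {1..n} (\<lambda>i. copies (m i) (coset_module G (H i)))) \<and>
      (\<forall>N. kG_submodule G N M \<and>
           (\<exists>k :: nat \<Rightarrow> nat. kG_iso G (M\<lparr>carrier := N\<rparr>)
              (direct_sum {1..n} (\<lambda>i. copies (k i) (coset_module G (H i)))))
         \<longrightarrow> kdim M N \<le> kdim M M') \<and>
      kdim M M' = (\<Sum>i = 1..n. m i * card (lcosets\<^bsub>G\<^esub> (H i))) \<and>
      ((\<forall>K. subgroup K G \<longrightarrow>
            (\<exists>i\<in>{1..n}. \<exists>g\<in>carrier G. H i = g <#\<^bsub>G\<^esub> (K #>\<^bsub>G\<^esub> inv\<^bsub>G\<^esub> g)))
         \<longrightarrow> (kdim M M' = kdim M (carrier M) \<longleftrightarrow> is_permutation_module G M))"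
proof -
  interpret kG_module G M by fact
  interpret trace_filtration_setup G M H T n
    by (intro trace_filtration_setup.intro trace_filtration_setup_axioms.intro)
      (use assms in auto)
  let ?J = "SIGMA i:{1..n}. {..<m i}"
  have m: "m i = layer_dim M H T i" if "i \<in> {1..n}" for i using assms(9) that by blast
  have sum_m: "(\<Sum>i = 1..n. layer_dim M H T i * card (lcosets\<^bsub>G\<^esub> (H i))) =
      (\<Sum>i = 1..n. m i * card (lcosets\<^bsub>G\<^esub> (H i)))"
    using m by (intro sum.cong) auto
  obtain v M' where M': "kG_submodule G M' M"
    and v: "orbit_basis G (M\<lparr>carrier := M'\<rparr>) ?J (H \<circ> fst) v"
    using maximal_submodule[OF m] .
  interpret M': kG_module G "M\<lparr>carrier := M'\<rparr>" using M' by (rule kG_module_submodule)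
  have H: "subgroup ((H \<circ> fst) j) G" if "j \<in> ?J" for j using that subgroup_H by auto
  have iso: "kG_iso G (M\<lparr>carrier := M'\<rparr>)
      (direct_sum {1..n} (\<lambda>i. copies (m i) (coset_module G (H i))))"
    using M'.kG_module_axioms kG_module_direct_sum_copies[OF is_group subgroup_H] finite_G H v
      orbit_basis_direct_sum_copies[OF is_group finite_G finite_atLeastAtMost subgroup_H]
    by (rule kG_iso_if_orbit_bases)
  have dim_M': "kdim M M' = (\<Sum>i = 1..n. m i * card (lcosets\<^bsub>G\<^esub> (H i)))"
    using M'.orbit_basis_dim[OF finite_G v] 
      sum_Sigma_fst[of "{1..n}" "\<lambda>i. card (lcosets\<^bsub>G\<^esub> (H i))" m] by simp
  have max: "kdim M N \<le> kdim M M'" if "kG_submodule G N M" "kG_iso G (M\<lparr>carrier := N\<rparr>)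
      (direct_sum {1..n} (\<lambda>i. copies (k i) (coset_module G (H i))))" for N and k :: "nat \<Rightarrow> nat"
    using dim_submodule_bound[OF that] dim_M' sum_m by simp
  have M'_sub: "subspace M'" "M' \<subseteq> carrier M" using M' by (simp_all add: kG_submodule_def)
  obtain W where W: "finite W" "carrier M \<subseteq> span W" by (rule carrier_finite_span)
  \<comment> \<open>Equal dimension forces \<open>M' = carrier M\<close>, and the translates of the
    generators are then a basis permuted by \<open>G\<close>.\<close>
  have perm: "is_permutation_module G M" if "kdim M M' = kdim M (carrier M)"
  proof -
    let ?S = "SIGMA j:?J. lcosets\<^bsub>G\<^esub> ((H \<circ> fst) j)" and ?e = "\<lambda>(j, C). coset_act M C (v j)"
    have "M' = carrier M" using subspace_eq_if_dim_eq[OF W M'_sub that] .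
    then have v': "orbit_basis G M ?J (H \<circ> fst) v" using v by simp
    have S: "finite ?S" using finite_lcosets[OF finite_G] by auto
    have E: "independent (?e ` ?S)" "span (?e ` ?S) = carrier M"
      using v' independent_family_iff[OF S, of ?e] unfolding orbit_basis_def by blast+
    have sub: "?e ` ?S \<subseteq> carrier M" unfolding E(2)[symmetric] by (rule span_superset)
    have v_fixed: "v j \<in> fixed_points M ((H \<circ> fst) j)" if "j \<in> ?J" for j
      using v' that unfolding orbit_basis_def by blast
    have "bij_betw (act M g) (?e ` ?S) (?e ` ?S)" if "g \<in> carrier G" for g
      using sub translates_invariant[OF H v_fixed] that by (rule act_bij_betw_invariant)
    then show ?thesis using E sub unfolding is_permutation_module_def by blast
  qed
  \<comment> \<open>The bound for permutation modules is exactly \<open>kdim M M'\<close>; the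
    opposite inequality holds because \<open>M'\<close> lies in \<open>carrier M\<close>.\<close>
  have perm': "kdim M M' = kdim M (carrier M)" if "is_permutation_module G M"
    "\<forall>K. subgroup K G \<longrightarrow> (\<exists>i\<in>{1..n}. \<exists>g\<in>carrier G. H i = g <#\<^bsub>G\<^esub> (K #>\<^bsub>G\<^esub> inv\<^bsub>G\<^esub> g))"
    using dim_permutation_module_bound[OF that(1)] that(2) dim_M' sum_m dim_le_if_subset[OF W M'_sub(2)]
    by (intro order_antisym) auto
  show ?thesis using M' iso max dim_M' perm perm' by blast
qed

end
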